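(* Let $k\ge 2$ and $m\ge \frac{(7k^2+6k+2)^2}{16}+\frac{k^2-1}{4}$ be integers, and let $G$ be an isolate-free graph with exactly $m$ edges. If $$\rho(G)\ge \frac{k-1+\sqrt{4m-k^2+1}}{2},$$ then $G$ contains a $(2k-3)$-chorded $(2k+1)$-cycle unless $G\cong K_k\vee\left(\frac{m}{k}-\frac{k-1}{2}\right)K_1$ (this exception being possible only when $\frac{m}{k}-\frac{k-1}{2}$ is an integer).
   Context: All graphs are finite and simple. A graph is isolate-free if it has no isolated vertices (it need not be connected, and its number of vertices is not fixed). The size of a graph is its number of edges. $\rho(G)$ denotes the spectral radius of $G$, i.e. the largest eigenvalue of the adjacency matrix of $G$. A chord of a cycle $C$ in $G$ is an edge of $G$ that joins two vertices of $C$ and is not itself an edge of $C$. An $s$-chorded cycle is a cycle with at least $s$ chords; an $s$-chorded $\ell$-cycle is a cycle of length $\ell$ with at least $s$ chords. $kG$ denotes the disjoint union of $k$ copies of $G$; the join $G\vee H$ is obtained from the disjoint union of $G$ and $H$ by adding all edges between vertices of $G$ and vertices of $H$. $K_n$ is the complete graph on $n$ vertices. *)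

theory Defs
  imports Complex_Main "Jordan_Normal_Form.Spectral_Radius"
begin

record 'a ugraph =
  verts :: "'a set"
  edges :: "'a set set"

definition simple_graph :: "'a ugraph \<Rightarrow> bool" where
  "simple_graph G \<longleftrightarrow>
     finite (verts G) \<and> (\<forall>e \<in> edges G. e \<subseteq> verts G \<and> card e = 2)"

definition isolate_free :: "'a ugraph \<Rightarrow> bool" where
  "isolate_free G \<longleftrightarrow> (\<forall>v \<in> verts G. \<exists>w. {v, w} \<in> edges G)"

definition graph_iso :: "'a ugraph \<Rightarrow> 'b ugraph \<Rightarrow> bool" where
  "graph_iso G H \<longleftrightarrow>
     (\<exists>f. bij_betw f (verts G) (verts H) \<and>
        (\<forall>u \<in> verts G. \<forall>v \<in> verts G. {u, v} \<in> edges G \<longleftrightarrow> {f u, f v} \<in> edges H))"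

text \<open>The list \<open>xs\<close> fixes the order of rows and columns. Different orders of the same vertex set
  give matrices that are conjugate by a permutation matrix, so the arbitrary choice made in
  \<open>graph_spectral_radius\<close> does not affect the eigenvalues.\<close>

definition adjacency_matrix :: "'a ugraph \<Rightarrow> 'a list \<Rightarrow> real mat" where
  "adjacency_matrix G xs =
     mat (length xs) (length xs) (\<lambda>(i, j). if {xs ! i, xs ! j} \<in> edges G then 1 else 0)"

definition vertex_order :: "'a ugraph \<Rightarrow> 'a list" where
  "vertex_order G = (SOME xs. distinct xs \<and> set xs = verts G)"

text \<open>The largest eigenvalue over the reals; the adjacency matrix is real symmetric, so it has no
  other eigenvalues. The maximum is meaningful for a graph with at least one vertex.\<close>

definition graph_spectral_radius :: "'a ugraph \<Rightarrow> real" where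
  "graph_spectral_radius G = Max (spectrum (adjacency_matrix G (vertex_order G)))"

text \<open>A cycle is given by the list of its vertices in cyclic order.\<close>

definition cycle_edges :: "'a list \<Rightarrow> 'a set set" where
  "cycle_edges c = {{c ! i, c ! (Suc i mod length c)} | i. i < length c}"

definition is_cycle :: "'a ugraph \<Rightarrow> 'a list \<Rightarrow> bool" where
  "is_cycle G c \<longleftrightarrow>
     length c \<ge> 3 \<and> distinct c \<and> set c \<subseteq> verts G \<and> cycle_edges c \<subseteq> edges G"

definition chords :: "'a ugraph \<Rightarrow> 'a list \<Rightarrow> 'a set set" where
  "chords G c = {e \<in> edges G. e \<subseteq> set c \<and> e \<notin> cycle_edges c}"

definition contains_chorded_cycle :: "'a ugraph \<Rightarrow> nat \<Rightarrow> nat \<Rightarrow> bool" where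
  "contains_chorded_cycle G s l \<longleftrightarrow>
     (\<exists>c. is_cycle G c \<and> length c = l \<and> card (chords G c) \<ge> s)"

definition complete_graph :: "nat \<Rightarrow> nat ugraph" where
  "complete_graph n = \<lparr>verts = {..<n}, edges = {e. e \<subseteq> {..<n} \<and> card e = 2}\<rparr>"

definition graph_copies :: "nat \<Rightarrow> 'a ugraph \<Rightarrow> (nat \<times> 'a) ugraph" where
  "graph_copies t G =
     \<lparr>verts = {..<t} \<times> verts G, edges = {Pair i ` e | i e. i < t \<and> e \<in> edges G}\<rparr>"

definition graph_join :: "'a ugraph \<Rightarrow> 'b ugraph \<Rightarrow> ('a + 'b) ugraph" where
  "graph_join G H =
     \<lparr>verts = verts G <+> verts H,
      edges = (image Inl ` edges G) \<union> (image Inr ` edges H)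
              \<union> {{Inl u, Inr v} | u v. u \<in> verts G \<and> v \<in> verts H}\<rparr>"

end

theory Submission
  imports Defs
begin

text \<open>Let \<open>x\<close> be the absolute value of an eigenvector, scaled to maximum \<open>1 = x u\<close>, let \<open>N\<close> be the
  neighbourhood of \<open>u\<close> and \<open>W\<close> the set of the other vertices, and put
  \<open>\<eta>(U) = (\<Sum>v\<in>U. (d\<^sub>U(v) - k + 1) x\<^sub>v) - e(U)\<close>. Counting walks of length two from \<open>u\<close>, the
  hypothesis on \<open>\<rho>\<close> becomes \<open>\<eta>(N) \<ge> e(W) - k(k-1)/2\<close> up to nonnegative slack terms.
  If there is no chorded cycle, then \<open>N\<close> contains no path on \<open>2k\<close> vertices, because \<open>u\<close> would close
  it to a cycle with \<open>2k - 2\<close> chords at \<open>u\<close>. Pass to the core of \<open>N\<close> of minimum degree \<open>k - 1\<close>,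
  which only increases \<open>\<eta>\<close>. A component \<open>C\<close> of the core with at least \<open>2k\<close> vertices has
  \<open>\<eta>(C) \<le> -k(k-1)/2\<close>, with equality only for \<open>K\<^sub>k\<^sub>-\<^sub>1\<close> joined to an independent set; a smaller one has
  \<open>\<eta>(C) \<le> -c x(C)\<close> for some \<open>c\<close> with \<open>c \<rho> > k(k-1)/2\<close>. Since \<open>x(N) \<ge> \<rho>\<close>, small components alone
  cannot satisfy the inequality, so there is exactly one component, it is large, and all slack
  vanishes, which forces the exceptional graph.\<close>

section \<open>A subharmonic vector for the spectral radius\<close>

text \<open>The obstacle is a component \<open>C\<close> of the core with exactly 2k - 1 vertices.
  The complete graph of that order has no path on 2k vertices, and with all weights 1 its
  \<open>eta\<close> is 0, so counting edges gives no deficit. If \<open>C\<close> is nearly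
  complete, then \<open>C\<close> together with \<open>u\<close> has a Hamiltonian path between any
  two of its vertices; an outside vertex with two neighbours in \<open>C\<close> would close such a
  path to a cycle of length 2k + 1 on which \<open>u\<close> has 2k - 1 neighbours. So the outside
  vertices other than \<open>u\<close> have at most one neighbour in \<open>C\<close> each, and
  summing the eigenvector inequality over \<open>C\<close> gives total weight at most 2, far below
  the 2k - 1 needed for \<open>eta\<close> near 0. Deficits of small components are measured in
  proportion to their weight because, without a large component, the only lower bound at hand is the
  one on the total weight of \<open>N\<close>. That this beats k(k - 1)/2 is where \<rho> must be
  quadratic in k: the bound on m yields \<rho> \<ge> 7k^2/4 + 2k. As G may be disconnected, the
  vector is not known to be positive; positivity is recovered on \<open>N\<close> alone, once all
  slack has vanished.\<close>

lemma spectrum_real_symmetric_nonempty: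
  fixes A :: "real mat"
  assumes A: "A \<in> carrier_mat n n" and n: "n > 0"
    and sym: "\<And>i j. i < n \<Longrightarrow> j < n \<Longrightarrow> A $$ (i, j) = A $$ (j, i)"
  shows "spectrum A \<noteq> {}"
proof -
  let ?B = "map_mat complex_of_real A"
  have B: "?B \<in> carrier_mat n n" using A by simp
  \<comment> \<open>\<open>Max\<close> of an empty spectrum would say nothing, and a real matrix may
    lack real eigenvalues. A complex eigenvalue \<open>l\<close> exists; symmetry makes
    \<open>l * S\<close> self-conjugate, where \<open>S\<close> is the squared norm of
    \<open>z\<close>, so \<open>l\<close> is real.\<close>
  obtain l where l: "l \<in> spectrum ?B" using spectrum_non_empty[OF B n] by auto
  then obtain z where z: "eigenvector ?B z l"
    by (auto simp: spectrum_def eigenvalue_def)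
  have zd: "z \<in> carrier_vec n" "z \<noteq> 0\<^sub>v n" "?B *\<^sub>v z = l \<cdot>\<^sub>v z"
    using z B unfolding eigenvector_def by auto
  define S where "S = (\<Sum>i<n. cnj (z $ i) * z $ i)"
  have row: "(\<Sum>j<n. complex_of_real (A $$ (i, j)) * z $ j) = l * z $ i" if "i < n" for i
  proof -
    have "(?B *\<^sub>v z) $ i = l * z $ i" using zd that by simp
    moreover have "(?B *\<^sub>v z) $ i = (\<Sum>j<n. complex_of_real (A $$ (i, j)) * z $ j)"
      using that A zd(1) by (simp add: scalar_prod_def lessThan_atLeast0)
    ultimately show ?thesis by simp
  qed
  have 1: "l * S = (\<Sum>i<n. \<Sum>j<n. complex_of_real (A $$ (i, j)) * cnj (z $ i) * z $ j)"
  proof -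
    have "l * S = (\<Sum>i<n. cnj (z $ i) * (l * z $ i))"
      by (simp add: S_def sum_distrib_left algebra_simps)
    also have "\<dots> = (\<Sum>i<n. cnj (z $ i) * (\<Sum>j<n. complex_of_real (A $$ (i, j)) * z $ j))"
      by (intro sum.cong) (auto simp: row)
    also have "\<dots> = (\<Sum>i<n. \<Sum>j<n. complex_of_real (A $$ (i, j)) * cnj (z $ i) * z $ j)"
      by (simp add: sum_distrib_left algebra_simps)
    finally show ?thesis .
  qed
  have "cnj (l * S) = (\<Sum>i<n. \<Sum>j<n. complex_of_real (A $$ (i, j)) * z $ i * cnj (z $ j))"
    unfolding 1 by simp
  also have "\<dots> = (\<Sum>j<n. \<Sum>i<n. complex_of_real (A $$ (i, j)) * z $ i * cnj (z $ j))"
    by (rule sum.swap)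
  also have "\<dots> = l * S"
    unfolding 1 by (intro sum.cong) (auto simp: sym algebra_simps)
  finally have c: "cnj (l * S) = l * S" .
  have Sr: "S = of_real (\<Sum>i<n. (cmod (z $ i))\<^sup>2)"
    by (simp only: S_def of_real_sum complex_norm_square mult.commute)
  obtain i where i: "i < n" "z $ i \<noteq> 0" using zd(1,2) by (metis eq_vecI carrier_vecD index_zero_vec)
  have "(\<Sum>i<n. (cmod (z $ i))\<^sup>2) > 0"
    by (rule sum_pos2[of _ i]) (use i in auto)
  hence S0: "S \<noteq> 0" "cnj S = S" unfolding Sr by (simp_all only: of_real_eq_0_iff complex_cnj_complex_of_real)
  hence "cnj l = l" using c by simp
  then obtain r where r: "l = of_real r" by (metis Reals_cnj_iff Reals_cases)
  have "poly (char_poly ?B) l = 0"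
    using l spectrum_root_char_poly[OF B] by auto
  moreover have "char_poly ?B = map_poly complex_of_real (char_poly A)"
    by (rule of_real_hom.char_poly_hom[OF A])
  ultimately have "poly (char_poly A) r = 0"
    unfolding r by simp
  thus ?thesis using spectrum_root_char_poly[OF A] by auto
qed

lemma simple_graph_edgeD:
  assumes "simple_graph G" "{v, w} \<in> edges G"
  shows "v \<noteq> w" "v \<in> verts G" "w \<in> verts G"
proof -
  have c: "card {v, w} = 2" "{v, w} \<subseteq> verts G" using assms unfolding simple_graph_def by blast+
  show "v \<noteq> w" using c(1) by auto
  show "v \<in> verts G" "w \<in> verts G" using c(2) by auto
qed

text \<open>The entrywise absolute value of an eigenvector is only subharmonic in general, but this
  spares Perron--Frobenius theory and is all that is needed.\<close>

lemma spectral_radius_subharmonic: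
  fixes G :: "'a ugraph"
  assumes G: "simple_graph G" and ne: "verts G \<noteq> {}" and nn: "graph_spectral_radius G \<ge> 0"
  shows "\<exists>(x :: 'a \<Rightarrow> real) u. (\<forall>v\<in>verts G. 0 \<le> x v \<and> x v \<le> 1) \<and> u \<in> verts G \<and> x u = 1 \<and>
    (\<forall>v\<in>verts G. graph_spectral_radius G * x v \<le> (\<Sum>w\<in>{w \<in> verts G. {v, w} \<in> edges G}. x w))"
proof -
  have fin: "finite (verts G)" using G by (simp add: simple_graph_def)
  define xs where "xs = vertex_order G"
  have xs: "distinct xs" "set xs = verts G"
    unfolding xs_def vertex_order_def
    by (metis (mono_tags, lifting) finite_distinct_list[OF fin] someI_ex)+
  define n where "n = length xs"
  define A where "A = adjacency_matrix G xs"
  have A: "A \<in> carrier_mat n n" by (simp add: A_def adjacency_matrix_def n_def)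
  have Aij: "A $$ (i, j) = (if {xs ! i, xs ! j} \<in> edges G then 1 else 0)" if "i < n" "j < n" for i j
    using that by (simp add: A_def adjacency_matrix_def n_def)
  have n0: "n > 0" using ne xs by (auto simp: n_def)
  have "spectrum A \<noteq> {}"
    by (rule spectrum_real_symmetric_nonempty[OF A n0]) (auto simp: Aij insert_commute)
  define r where "r = graph_spectral_radius G"
  have "r \<in> spectrum A"
    unfolding r_def graph_spectral_radius_def xs_def[symmetric] A_def[symmetric]
    by (intro Max_in card_finite_spectrum[OF A]) fact
  then obtain z where "eigenvector A z r" by (auto simp: spectrum_def eigenvalue_def)
  hence z: "z \<in> carrier_vec n" "z \<noteq> 0\<^sub>v n" "A *\<^sub>v z = r \<cdot>\<^sub>v z"
    using A unfolding eigenvector_def by auto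
  obtain i0 where i0: "i0 < n" "z $ i0 \<noteq> 0" using z(1,2) by (metis eq_vecI carrier_vecD index_zero_vec)
  define M where "M = Max ((\<lambda>i. \<bar>z $ i\<bar>) ` {..<n})"
  have "M \<in> (\<lambda>i. \<bar>z $ i\<bar>) ` {..<n}" unfolding M_def by (rule Max_in) (use n0 in auto)
  then obtain i1 where i1: "i1 < n" "\<bar>z $ i1\<bar> = M" by auto
  have Mge: "\<bar>z $ i\<bar> \<le> M" if "i < n" for i unfolding M_def by (rule Max_ge) (use that in auto)
  have M0: "M > 0" using Mge[OF i0(1)] i0(2) by linarith
  have bij: "bij_betw ((!) xs) {..<n} (verts G)"
    using bij_betw_nth[OF xs(1)] xs(2) by (simp add: n_def)
  define f where "f = the_inv_into {..<n} ((!) xs)"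
  have f: "f (xs ! i) = i" if "i < n" for i
    unfolding f_def using that bij by (intro the_inv_into_f_f) (auto simp: bij_betw_def)
  define x where "x v = \<bar>z $ f v\<bar> / M" for v
  have ex: "\<exists>i<n. v = xs ! i" if "v \<in> verts G" for v
    using that xs(2) by (metis in_set_conv_nth n_def)
  have bounds: "0 \<le> x v \<and> x v \<le> 1"
    and sub: "r * x v \<le> (\<Sum>w\<in>{w \<in> verts G. {v, w} \<in> edges G}. x w)" if v: "v \<in> verts G" for v
  proof -
    obtain i where i: "i < n" "v = xs ! i" using ex[OF v] by auto
    show "0 \<le> x v \<and> x v \<le> 1" using M0 Mge[OF i(1)] by (simp add: x_def f i)
    have "r * z $ i = (A *\<^sub>v z) $ i" using z i by simp
    also have "\<dots> = (\<Sum>j<n. A $$ (i, j) * z $ j)"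
      using i A z(1) by (simp add: scalar_prod_def lessThan_atLeast0)
    finally have "\<bar>r * z $ i\<bar> \<le> (\<Sum>j<n. \<bar>A $$ (i, j) * z $ j\<bar>)" by (metis sum_abs)
    also have "\<dots> = (\<Sum>j<n. if {v, xs ! j} \<in> edges G then \<bar>z $ j\<bar> else 0)"
      by (intro sum.cong) (auto simp: Aij i)
    also have "\<dots> / M = (\<Sum>j<n. if {v, xs ! j} \<in> edges G then x (xs ! j) else 0)"
      unfolding sum_divide_distrib by (intro sum.cong) (auto simp: x_def f)
    also have "\<dots> = (\<Sum>w\<in>verts G. if {v, w} \<in> edges G then x w else 0)"
      by (rule sum.reindex_bij_betw[OF bij])
    also have "\<dots> = (\<Sum>w\<in>{w \<in> verts G. {v, w} \<in> edges G}. x w)"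
      by (rule sum.inter_filter[OF fin, symmetric])
    finally have "\<bar>r * z $ i\<bar> / M \<le> (\<Sum>w\<in>{w \<in> verts G. {v, w} \<in> edges G}. x w)"
      using M0 by (simp add: divide_right_mono)
    moreover have "r * x v = \<bar>r * z $ i\<bar> / M" using nn by (simp add: x_def f i abs_mult r_def)
    ultimately show "r * x v \<le> (\<Sum>w\<in>{w \<in> verts G. {v, w} \<in> edges G}. x w)" by simp
  qed
  moreover have "xs ! i1 \<in> verts G" using i1 xs n_def nth_mem by blast
  moreover have "x (xs ! i1) = 1" using i1 M0 by (simp add: x_def f)
  ultimately show ?thesis unfolding r_def by blast
qed

section \<open>Degrees and Hamiltonian paths\<close>

locale adjacency =
  fixes E :: "'a \<Rightarrow> 'a \<Rightarrow> bool"
  assumes E_sym: "E v w \<Longrightarrow> E w v" and E_irrefl: "\<not> E v v"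
begin

lemma E_commute: "E v w \<longleftrightarrow> E w v"
  using E_sym by blast

definition deg :: "'a set \<Rightarrow> 'a \<Rightarrow> nat" where
  "deg U v = card {w \<in> U. E v w}"

definition ecount :: "'a set \<Rightarrow> real" where
  "ecount U = (\<Sum>v\<in>U. real (deg U v)) / 2"

lemma deg_Un: "finite A \<Longrightarrow> finite B \<Longrightarrow> A \<inter> B = {} \<Longrightarrow> deg (A \<union> B) v = deg A v + deg B v"
  unfolding deg_def by (subst card_Un_disjoint[symmetric]) (auto intro!: arg_cong[of _ _ card])

lemma deg_less_card: "finite U \<Longrightarrow> v \<in> U \<Longrightarrow> deg U v < card U"
  unfolding deg_def using E_irrefl[of v] by (intro psubset_card_mono) blast+

lemma deg_full_iff: "finite U \<Longrightarrow> v \<in> U \<Longrightarrow> deg U v = card U - 1 \<longleftrightarrow> (\<forall>w\<in>U - {v}. E v w)"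
proof
  assume U: "finite U" "v \<in> U" and "deg U v = card U - 1"
  hence "card {w \<in> U. E v w} = card (U - {v})" by (simp add: deg_def)
  hence "{w \<in> U. E v w} = U - {v}"
    by (intro card_subset_eq) (use U E_irrefl in auto)
  thus "\<forall>w\<in>U - {v}. E v w" by blast
next
  assume U: "finite U" "v \<in> U" and "\<forall>w\<in>U - {v}. E v w"
  hence "{w \<in> U. E v w} = U - {v}" using E_irrefl by auto
  thus "deg U v = card U - 1" using U by (simp add: deg_def)
qed

lemma sum_swap_nbrs:
  assumes "finite A" "finite B"
  shows "(\<Sum>v\<in>A. \<Sum>w\<in>{w\<in>B. E v w}. f v w) = (\<Sum>w\<in>B. \<Sum>v\<in>{v\<in>A. E w v}. f v w)"
  using sum.swap_restrict[OF assms, of f E] by (simp add: E_commute)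

lemma sum_nbrs_swap_deg:
  fixes f :: "'a \<Rightarrow> real"
  assumes "finite A" "finite B"
  shows "(\<Sum>v\<in>A. \<Sum>w\<in>{w\<in>B. E v w}. f w) = (\<Sum>w\<in>B. real (deg A w) * f w)"
  using sum_swap_nbrs[OF assms, of "\<lambda>_ w. f w"] by (simp add: deg_def)

lemma sum_deg_swap:
  "finite A \<Longrightarrow> finite B \<Longrightarrow> (\<Sum>v\<in>A. real (deg B v)) = (\<Sum>w\<in>B. real (deg A w))"
  using sum_nbrs_swap_deg[of A B "\<lambda>_. 1"] by (simp add: deg_def)

lemma ecount_Un:
  assumes "finite A" "finite B" "A \<inter> B = {}"
  shows "ecount (A \<union> B) = ecount A + ecount B + (\<Sum>v\<in>B. real (deg A v))"
proof -
  have "2 * ecount (A \<union> B) = (\<Sum>v\<in>A. real (deg (A \<union> B) v)) + (\<Sum>v\<in>B. real (deg (A \<union> B) v))"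
    using assms by (simp add: ecount_def sum.union_disjoint)
  also have "\<dots> = (\<Sum>v\<in>A. real (deg A v)) + (\<Sum>v\<in>A. real (deg B v)) +
      ((\<Sum>v\<in>B. real (deg A v)) + (\<Sum>v\<in>B. real (deg B v)))"
    by (simp add: deg_Un[OF assms] sum.distrib)
  also have "(\<Sum>v\<in>A. real (deg B v)) = (\<Sum>v\<in>B. real (deg A v))"
    by (rule sum_deg_swap[OF assms(1,2)])
  finally show ?thesis by (simp add: ecount_def)
qed

lemma deg_remove_self: "deg (U - {p}) p = deg U p"
  unfolding deg_def by (rule arg_cong[of _ _ card]) (auto simp: E_irrefl)

lemma ecount_remove:
  assumes "finite U" "p \<in> U"
  shows "ecount U = ecount (U - {p}) + deg U p"
proof -
  have "ecount ((U - {p}) \<union> {p}) = ecount (U - {p}) + ecount {p} + (\<Sum>v\<in>{p}. real (deg (U - {p}) v))"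
    by (rule ecount_Un) (use assms in auto)
  moreover have "deg {p} p = 0" by (simp add: deg_def E_irrefl)
  ultimately show ?thesis using assms by (simp add: deg_remove_self ecount_def insert_absorb)
qed

lemma ecount_nonneg: "ecount U \<ge> 0"
  by (simp add: ecount_def sum_nonneg)

lemma ecount_le:
  assumes "finite U"
  shows "ecount U \<le> real (card U) * (real (card U) - 1) / 2"
proof -
  have "(\<Sum>v\<in>U. real (deg U v)) \<le> (\<Sum>v\<in>U. real (card U) - 1)"
    using deg_less_card[OF assms] by (intro sum_mono) fastforce
  thus ?thesis by (simp add: ecount_def)
qed

lemma ecount_eq_complete:
  assumes "finite U" "ecount U \<ge> real (card U) * (real (card U) - 1) / 2" "v \<in> U" "w \<in> U" "v \<noteq> w"
  shows "E v w"
proof (rule ccontr)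
  assume "\<not> E v w"
  hence "\<not> (deg U v = card U - 1)" using deg_full_iff[OF assms(1,3)] assms by auto
  hence "real (deg U v) < real (card U) - 1" using deg_less_card[OF assms(1,3)] by linarith
  hence "(\<Sum>v\<in>U. real (deg U v)) < (\<Sum>v\<in>U. real (card U) - 1)"
    using deg_less_card[OF assms(1)] assms(1,3) by (intro sum_strict_mono_ex1) fastforce+
  thus False using assms(2) by (simp add: ecount_def)
qed

definition is_path :: "'a set \<Rightarrow> 'a list \<Rightarrow> bool" where
  "is_path U xs \<longleftrightarrow> set xs \<subseteq> U \<and> distinct xs \<and> successively E xs"

definition is_cyc :: "'a set \<Rightarrow> 'a list \<Rightarrow> bool" where
  "is_cyc U c \<longleftrightarrow> is_path U c \<and> length c \<ge> 3 \<and> E (last c) (hd c)"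

text \<open>If the two leading entries are not both neighbours of \<open>p\<close>, dropping both
  removes at least one non-neighbour, so the inequality survives.\<close>

lemma insertion_slot:
  "length xs > 2 * length (filter (\<lambda>v. \<not> E p v) xs) + 1 \<Longrightarrow>
   \<exists>ys v w zs. xs = ys @ v # w # zs \<and> E p v \<and> E p w"
proof (induction xs rule: induct_list012)
  case (3 x y zs)
  show ?case
  proof (cases "E p x \<and> E p y")
    case True
    thus ?thesis by (metis append_Nil)
  next
    case False
    hence "length zs > 2 * length (filter (\<lambda>v. \<not> E p v) zs) + 1" using 3 by (auto split: if_splits)
    then obtain ys v w us where "zs = ys @ v # w # us" "E p v" "E p w" using 3 by blast
    thus ?thesis by (metis append_Cons)
  qed
qed auto

text \<open>By induction: remove a vertex with a non-neighbour (any vertex if there is none) and insert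
  it again into the path found in the rest; each non-neighbour blocks at most two slots.\<close>

lemma hamilton_connected:
  assumes "finite S" "a \<in> S" "b \<in> S" "a \<noteq> b" "card S \<ge> 3"
    and "(\<forall>p\<in>S - {a, b}. deg S p = card S - 1) \<or>
         card S * (real (card S) - 1) - 2 * ecount S + 3 \<le> card S"
  shows "\<exists>xs. is_path S xs \<and> set xs = S \<and> hd xs = a \<and> last xs = b"
  using assms
proof (induction "card S" arbitrary: S rule: less_induct)
  case less
  define n where "n = card S"
  have n3: "n \<ge> 3" using less n_def by simp
  let ?full = "\<forall>p\<in>S - {a, b}. deg S p = n - 1"
  have "card (S - {a, b}) > 0" using less n3 by (simp add: card_Diff_subset n_def)
  hence ne: "S - {a, b} \<noteq> {}" by force
  obtain p where p: "p \<in> S - {a, b}" "\<not> ?full \<Longrightarrow> deg S p < n - 1"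
  proof (cases ?full)
    case True
    then show ?thesis using ne that by blast
  next
    case False
    then obtain p where p: "p \<in> S - {a, b}" "deg S p \<noteq> n - 1" by blast
    moreover have "deg S p < n" using deg_less_card[OF less(2), of p] p by (auto simp: n_def)
    ultimately show ?thesis using that[of p] by linarith
  qed
  have pd: "deg S p \<le> n - 1" using deg_less_card[OF less(2), of p] p by (auto simp: n_def)
  have cS: "card (S - {p}) = n - 1" using p less by (simp add: n_def)
  have ec: "ecount S = ecount (S - {p}) + deg S p" by (rule ecount_remove) (use less p in auto)
  have ecl: "ecount (S - {p}) \<le> (real n - 1) * (real n - 2) / 2"
    using ecount_le[of "S - {p}"] less cS n3 by (simp add: of_nat_diff)
  \<comment> \<open>The second hypothesis bounds twice the number of missing edges by n - 3. Those
    missing at \<open>p\<close> are among them, so the non-neighbours of \<open>p\<close> block at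
    most n - 3 of the n - 2 slots.\<close>
  have slot: "2 * (n - 1 - deg S p) + 1 < n - 1 \<or> n = 3"
  proof (cases ?full)
    case True
    thus ?thesis using p n3 by auto
  next
    case False
    hence "n * (real n - 1) - 2 * ecount S + 3 \<le> n" using less n_def by metis
    hence "n * (real n - 1) - (real n - 1) * (real n - 2) - 2 * deg S p + 3 \<le> n" using ec ecl by simp
    hence "2 * (real n - 1) - 2 * deg S p + 3 \<le> real n" by (simp add: algebra_simps)
    hence "real (n + 1) \<le> real (2 * deg S p)" by simp
    hence "n + 1 \<le> 2 * deg S p" by (simp only: of_nat_le_iff)
    thus ?thesis using pd by linarith
  qed
  show ?case
  proof (cases "n = 3")
    case True
    have S3: "S = {a, b, p}"
      by (rule sym, rule card_subset_eq) (use less p True in \<open>auto simp: n_def card_insert_if\<close>)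
    have "deg S p = n - 1"
    proof (rule ccontr)
      assume nd: "\<not> ?thesis"
      hence "n * (real n - 1) - 2 * ecount S + 3 \<le> n" using less p n_def by metis
      hence "2 * (real n - 1) - 2 * deg S p + 3 \<le> real n" using ec ecl by (simp add: algebra_simps)
      thus False using pd nd True by simp
    qed
    hence "E p a" "E p b" using deg_full_iff[OF less(2), of p] p less by (auto simp: n_def)
    hence "is_path S [a, p, b]" using S3 p less by (auto simp: is_path_def E_sym)
    thus ?thesis using S3 by (intro exI[of _ "[a, p, b]"]) auto
  next
    case False
    \<comment> \<open>If \<open>p\<close> has a non-neighbour, twice the number of missing edges
      falls by at least 2 while the number of vertices falls by 1.\<close>
    have disj: "(\<forall>q\<in>(S - {p}) - {a, b}. deg (S - {p}) q = card (S - {p}) - 1) \<or>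
         card (S - {p}) * (real (card (S - {p})) - 1) - 2 * ecount (S - {p}) + 3 \<le> card (S - {p})"
    proof (cases ?full)
      case True
      hence "\<forall>w\<in>S - {q}. E q w" if "q \<in> S - {a, b}" for q
        using that deg_full_iff[OF less(2), of q] by (auto simp: n_def)
      hence "deg (S - {p}) q = card (S - {p}) - 1" if "q \<in> (S - {p}) - {a, b}" for q
        using that deg_full_iff[of "S - {p}" q] less(2) by auto
      thus ?thesis by blast
    next
      case False
      hence "n * (real n - 1) - 2 * ecount S + 3 \<le> n" using less n_def by metis
      moreover have "real (deg S p) \<le> real n - 2" using p(2)[OF False] n3 by linarith
      ultimately have "(real n - 1) * (real n - 2) - 2 * ecount (S - {p}) + 3 \<le> real n - 1"
        using ec by (simp add: algebra_simps)
      thus ?thesis using cS n3 by (simp add: of_nat_diff)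
    qed
    have pre: "card (S - {p}) < card S" "finite (S - {p})" "a \<in> S - {p}" "b \<in> S - {p}" "card (S - {p}) \<ge> 3"
      using less(2-5) p(1) cS n3 False by (auto simp: n_def)
    obtain xs where xs: "is_path (S - {p}) xs" "set xs = S - {p}" "hd xs = a" "last xs = b"
      using less(1)[OF pre(1-4) less(5) pre(5) disj] by blast
    have len: "length xs = n - 1" using xs cS by (metis is_path_def distinct_card)
    have "length (filter (\<lambda>v. \<not> E p v) xs) = card {v \<in> S - {p}. \<not> E p v}"
      using xs by (metis distinct_card distinct_filter is_path_def set_filter)
    also have "\<dots> = card (S - {p} - {v \<in> S. E p v})" by (rule arg_cong[of _ _ card]) auto
    also have "\<dots> = n - 1 - deg S p"
      unfolding deg_def using less(2) E_irrefl cS by (subst card_Diff_subset) auto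
    finally have "length xs > 2 * length (filter (\<lambda>v. \<not> E p v) xs) + 1" using slot len False by simp
    then obtain ys v w zs where s: "xs = ys @ v # w # zs" "E p v" "E p w" using insertion_slot by blast
    have "is_path S (ys @ v # p # w # zs)"
      using xs s p by (auto simp: is_path_def successively_append_iff successively_Cons E_sym)
    moreover have "set (ys @ v # p # w # zs) = S" using xs(2) s(1) p by auto
    moreover have "hd (ys @ v # p # w # zs) = a" "last (ys @ v # p # w # zs) = b"
      using xs(3,4) unfolding s(1) by (simp_all add: hd_append split: if_splits)
    ultimately show ?thesis by blast
  qed
qed

section \<open>Connected graphs without long paths\<close>

text \<open>Stated by cuts instead of walks: what the arguments ask for is an edge leaving a given
  proper subset.\<close>

definition connected_in :: "'a set \<Rightarrow> bool" where
  "connected_in C \<longleftrightarrow> C \<noteq> {} \<and>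
     (\<forall>B\<subseteq>C. B \<noteq> {} \<longrightarrow> (\<forall>v\<in>B. \<forall>w\<in>C - B. \<not> E v w) \<longrightarrow> B = C)"

lemma connected_inD:
  "connected_in C \<Longrightarrow> B \<subseteq> C \<Longrightarrow> B \<noteq> {} \<Longrightarrow> B \<noteq> C \<Longrightarrow> \<exists>v\<in>B. \<exists>w\<in>C - B. E v w"
  unfolding connected_in_def by blast

lemma successively_flip [simp]: "successively (\<lambda>x y. E y x) xs = successively E xs"
  by (simp add: successively_conv_nth E_commute)

lemma is_cyc_rotate1: "is_cyc U c \<Longrightarrow> is_cyc U (rotate1 c)"
proof (cases c)
  case (Cons x xs)
  assume "is_cyc U c"
  moreover from this have "xs \<noteq> []" using Cons by (auto simp: is_cyc_def)
  ultimately show ?thesis using Cons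
    by (auto simp: is_cyc_def is_path_def successively_append_iff successively_Cons)
qed auto

lemma is_cyc_rotate: "is_cyc U c \<Longrightarrow> is_cyc U (rotate i c)"
  by (induction i) (auto simp: rotate_Suc is_cyc_rotate1)

lemma is_path_length: "finite U \<Longrightarrow> is_path U xs \<Longrightarrow> length xs \<le> card U"
  unfolding is_path_def by (metis card_mono distinct_card)

lemma ex_longest_path:
  assumes "finite U" "P xs" "\<And>xs. P xs \<Longrightarrow> is_path U xs"
  obtains ys where "P ys" "\<And>zs. P zs \<Longrightarrow> length zs \<le> length ys"
proof -
  have "\<forall>y. P y \<longrightarrow> length y < Suc (card U)" using assms is_path_length by (auto simp: less_Suc_eq_le)
  then obtain ys where "P ys" "\<forall>zs. P zs \<longrightarrow> length zs \<le> length ys"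
    using ex_has_greatest_nat[of P xs length "Suc (card U)"] assms(2) by auto
  thus thesis using that[of ys] by blast
qed

text \<open>\<open>ds\<close> is a tail that leaves the longest cycle \<open>p # q\<close> at \<open>p\<close> and cannot be extended. The
  positions \<open>J\<close> of the neighbours of its end on \<open>q\<close> keep distance \<open>length ds\<close> from \<open>p\<close> and are pairwise
  non-consecutive, as otherwise the cycle could be enlarged; counting \<open>J \<union> Suc ` J\<close> then leaves a
  single possibility.\<close>

lemma longest_cycle_gap:
  assumes C: "finite C" and c: "is_cyc C (p # q)"
    and cmax: "\<forall>c'. is_cyc C c' \<longrightarrow> length c' \<le> length (p # q)"
    and clen: "length (p # q) \<ge> k + 1"
    and nopath: "\<forall>xs. is_path C xs \<longrightarrow> length xs < 2 * k"
    and mindeg: "\<forall>v\<in>C. k \<le> deg C v + 1"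
    and D: "is_path (C - set (p # q)) ds" "ds \<noteq> []" "E p (hd ds)"
    and Dmax: "\<forall>w\<in>C - set (p # q) - set ds. \<not> E (last ds) w"
  shows "length ds = 1" "length (p # q) = 2 * k - 2" "deg C (last ds) = k - 1"
    "{w\<in>C. E (last ds) w} = {(p # q) ! j | j. j < 2 * k - 2 \<and> even j}"
proof -
  define y where "y = last ds"
  define s where "s = length ds"
  define n where "n = length (p # q)"
  define J where "J = {j. j < length q \<and> E y (q ! j)}"
  have s1: "s \<ge> 1" using D(2) by (cases ds) (auto simp: s_def)
  have n3: "n \<ge> 3" using c by (auto simp: is_cyc_def n_def)
  have q: "q \<noteq> []" using n3 by (auto simp: n_def)
  have cE: "E p (hd q)" "successively E q" "E (last q) p" "distinct q" "p \<notin> set q" "p \<in> C" "set q \<subseteq> C"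
    using c q by (auto simp: is_cyc_def is_path_def successively_Cons)
  have dE: "successively E ds" "distinct ds" "set ds \<subseteq> C" "set ds \<inter> set q = {}" "p \<notin> set ds"
    using D by (auto simp: is_path_def)
  have y: "y \<in> set ds" using D by (simp add: y_def)
  have "is_path C (rev ds @ p # q)"
    using cE dE D q by (auto simp: is_path_def successively_append_iff successively_Cons last_rev E_sym)
  hence sn: "s + n < 2 * k" using nopath by (fastforce simp: s_def n_def)
  have sub: "{w\<in>C. E y w} \<subseteq> (set ds - {y}) \<union> insert p ((!) q ` J)"
  proof
    fix w assume "w \<in> {w\<in>C. E y w}"
    hence w: "w \<in> C" "E y w" by auto
    hence "w \<in> set ds \<or> w = p \<or> w \<in> set q" using Dmax unfolding y_def by auto
    moreover have "w \<in> (!) q ` J" if "w \<in> set q"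
      using that w by (auto simp: in_set_conv_nth J_def)
    ultimately show "w \<in> (set ds - {y}) \<union> insert p ((!) q ` J)" using w E_irrefl by auto
  qed
  have finJ: "finite J" by (simp add: J_def)
  have Jle: "card (insert p ((!) q ` J)) \<le> 1 + card J"
    using card_image_le[OF finJ, of "(!) q"] finJ by (simp add: card_insert_if)
  have "card {w\<in>C. E y w} \<le> card ((set ds - {y}) \<union> insert p ((!) q ` J))"
    by (rule card_mono) (use sub finJ in auto)
  also have "\<dots> \<le> card (set ds - {y}) + card (insert p ((!) q ` J))" by (rule card_Un_le)
  also have "card (set ds - {y}) = s - 1" using y dE by (simp add: s_def distinct_card)
  finally have degy: "deg C y \<le> s + card J" using Jle s1 unfolding deg_def by linarith
  have yC: "y \<in> C" using y dE by auto
  have kJ: "k \<le> s + card J + 1" using degy bspec[OF mindeg yC] by linarith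
  have lo: "s \<le> j" and hi: "Suc j + s \<le> n - 1" if j: "j \<in> J" for j
  proof -
    have j': "j < length q" "E y (q ! j)" using j by (auto simp: J_def)
    have td: "hd (drop j q) = q ! j" "last (drop j q) = last q" "drop j q \<noteq> []"
      using j' by (auto simp: hd_drop_conv_nth)
    have sd: "successively E (drop j q)" "successively E (take (Suc j) q)"
      using cE(2) append_take_drop_id[of j q] append_take_drop_id[of "Suc j" q] by (metis successively_append_iff)+
    have tt: "last (take (Suc j) q) = q ! j" "hd (take (Suc j) q) = hd q" "take (Suc j) q \<noteq> []"
      using j' q by (auto simp: take_Suc_conv_app_nth hd_append hd_conv_nth)
    have "set (drop j q) \<subseteq> set q" "set (take (Suc j) q) \<subseteq> set q"
      by (simp_all add: set_drop_subset set_take_subset)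
    hence st: "p \<notin> set (drop j q)" "p \<notin> set (take (Suc j) q)" "set ds \<inter> set (drop j q) = {}"
      "set ds \<inter> set (take (Suc j) q) = {}" "set (drop j q) \<subseteq> C" "set (take (Suc j) q) \<subseteq> C"
      using cE dE by blast+
    \<comment> \<open>The tail replaces the \<open>j\<close> cycle vertices before
      \<open>q ! j\<close>; the second cycle below goes round the other way and replaces those after
      it.\<close>
    have "is_cyc C (p # ds @ drop j q)"
      using cE dE D j' td sd st s1
      by (auto simp: is_cyc_def is_path_def successively_append_iff successively_Cons y_def s_def)
    from cmax[rule_format, OF this] show "s \<le> j" using j' by (simp add: s_def n_def)
    have "is_cyc C (p # ds @ rev (take (Suc j) q))"
      using cE dE D j' tt sd st s1
      by (auto simp: is_cyc_def is_path_def successively_append_iff successively_Cons y_def s_def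
          hd_rev last_rev E_sym simp del: take_Suc)
    from cmax[rule_format, OF this] show "Suc j + s \<le> n - 1" using j' by (simp add: s_def n_def)
  qed
  have nc: False if j: "j \<in> J" "Suc j \<in> J" for j
  proof -
    have j': "j < length q" "E y (q ! j)" "Suc j < length q" "E y (q ! Suc j)" using j by (auto simp: J_def)
    have td: "hd (drop (Suc j) q) = q ! Suc j" "last (drop (Suc j) q) = last q" "drop (Suc j) q \<noteq> []"
      using j' by (auto simp: hd_drop_conv_nth)
    have sd: "successively E (drop (Suc j) q)" "successively E (take (Suc j) q)"
      using cE(2) append_take_drop_id[of "Suc j" q] by (metis successively_append_iff)+
    have tt: "last (take (Suc j) q) = q ! j" "hd (take (Suc j) q) = hd q" "take (Suc j) q \<noteq> []"
      using j' q by (auto simp: take_Suc_conv_app_nth hd_append hd_conv_nth)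
    have dd: "set (take (Suc j) q) \<inter> set (drop (Suc j) q) = {}"
      using cE by (intro set_take_disj_set_drop_if_distinct) auto
    have ss: "set (take (Suc j) q) \<union> set (drop (Suc j) q) = set q"
      by (metis append_take_drop_id set_append)
    have yq: "y \<notin> set q" "y \<noteq> p" using y dE by auto
    have "is_cyc C (p # take (Suc j) q @ y # drop (Suc j) q)"
      using cE dE D j' td tt sd ss dd yq yC
      by (auto simp: is_cyc_def is_path_def successively_append_iff successively_Cons E_sym simp del: take_Suc)
    from cmax[rule_format, OF this] show False using j' by simp
  qed
  have "J \<union> Suc ` J \<subseteq> {s..n - 1 - s}"
  proof
    fix i assume "i \<in> J \<union> Suc ` J"
    thus "i \<in> {s..n - 1 - s}" using lo hi by fastforce
  qed
  moreover have cJ2: "card (J \<union> Suc ` J) = 2 * card J"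
    using nc finJ by (subst card_Un_disjoint) (auto simp: card_image)
  ultimately have J2: "2 * card J \<le> Suc (n - 1 - s) - s"
    using card_mono[of "{s..n - 1 - s}" "J \<union> Suc ` J"] by simp
  have nk: "n \<ge> k + 1" using clen by (simp add: n_def)
  \<comment> \<open>The assumption \<open>clen\<close> enters here: since \<open>J\<close> is
    nonempty, the subtraction in \<open>J2\<close> is not truncated at 0.\<close>
  have "card J \<ge> 1" using nk kJ sn by linarith
  hence J2': "2 * card J + 2 * s \<le> n" using J2 by linarith
  have "s \<le> 1" using J2' kJ sn by linarith
  hence res1: "s = 1" using s1 by simp
  have "n + 2 \<ge> 2 * k" using J2' kJ res1 by linarith
  hence res2: "n + 2 = 2 * k" using sn res1 by linarith
  hence res3: "card J + 2 = k" using J2' kJ res1 by linarith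
  have res: "s = 1" "n = 2 * k - 2" "card J = k - 2" "k \<ge> 3"
    using res1 res2 res3 nk by linarith+
  show "length ds = 1" "length (p # q) = 2 * k - 2" using res by (auto simp: s_def n_def)
  have "J \<union> Suc ` J = {s..n - 1 - s}"
    by (rule card_subset_eq) (use cJ2 res \<open>J \<union> Suc ` J \<subseteq> _\<close> in auto)
  moreover have "n - 1 - s = 2 * k - 4" using res1 res2 by linarith
  ultimately have JS: "J \<union> Suc ` J = {1..2 * k - 4}" using res1 by simp
  \<comment> \<open>All estimates are tight. A set without consecutive elements that covers {1..2k -
    4} together with its shift consists of the odd numbers; in \<open>p # q\<close> these become
    even positions, with \<open>p\<close> at 0.\<close>
  have Jodd: "j \<in> J \<longleftrightarrow> odd j" if "j \<le> 2 * k - 4" for j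
    using that
  proof (induction j)
    case 0
    thus ?case using lo[of 0] res by auto
  next
    case (Suc j)
    have IH: "j \<in> J \<longleftrightarrow> odd j" using Suc by simp
    have "Suc j \<in> J \<union> Suc ` J" unfolding JS using Suc by simp
    hence "Suc j \<in> J \<or> j \<in> J" by auto
    thus ?case using IH nc[of j] by auto
  qed
  have "deg C y \<ge> k - 1" using bspec[OF mindeg yC] by simp
  thus dk: "deg C (last ds) = k - 1" using degy res unfolding y_def by simp
  have Jlt: "j \<le> 2 * k - 4" if "j \<in> J" for j using that JS by auto
  have dsy: "set ds - {y} = {}"
    using res y unfolding s_def by (cases ds) auto
  have "{w\<in>C. E y w} = insert p ((!) q ` J)"
    by (rule card_seteq) (use finJ sub dsy Jle res dk in \<open>auto simp: deg_def y_def\<close>)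
  also have "\<dots> = {(p # q) ! j | j. j < 2 * k - 2 \<and> even j}"
  proof (intro equalityI subsetI)
    fix w assume "w \<in> insert p ((!) q ` J)"
    then consider "w = p" | j where "j \<in> J" "w = q ! j" by auto
    thus "w \<in> {(p # q) ! j | j. j < 2 * k - 2 \<and> even j}"
    proof cases
      case 1
      hence "w = (p # q) ! 0" "0 < 2 * k - 2" "even (0::nat)" using res by auto
      thus ?thesis by blast
    next
      case 2
      hence "w = (p # q) ! Suc j" "Suc j < 2 * k - 2" "even (Suc j)"
        using Jodd[of j] Jlt[of j] res by auto
      thus ?thesis by blast
    qed
  next
    fix w assume "w \<in> {(p # q) ! j | j. j < 2 * k - 2 \<and> even j}"
    then obtain j where j: "w = (p # q) ! j" "j < 2 * k - 2" "even j" by auto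
    show "w \<in> insert p ((!) q ` J)"
    proof (cases j)
      case (Suc i)
      hence "odd i" "i \<le> 2 * k - 4" using j by (auto)
      thus ?thesis using Jodd[of i] j Suc by auto
    qed (use j in auto)
  qed
  finally show "{w\<in>C. E (last ds) w} = {(p # q) ! j | j. j < 2 * k - 2 \<and> even j}"
    unfolding y_def .
qed

text \<open>The tail is a longest path from \<open>y\<close> outside the cycle. It turns out to have
  a single vertex, so what \<open>longest_cycle_gap\<close> says about its end holds for
  \<open>y\<close>. Rotating \<open>c ! i\<close> to the head causes the shifted indices.\<close>

lemma longest_cycle_outside:
  assumes C: "finite C" and c: "is_cyc C c"
    and cmax: "\<forall>c'. is_cyc C c' \<longrightarrow> length c' \<le> length c"
    and clen: "length c \<ge> k + 1"
    and nopath: "\<forall>xs. is_path C xs \<longrightarrow> length xs < 2 * k"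
    and mindeg: "\<forall>v\<in>C. k \<le> deg C v + 1"
    and y: "y \<in> C - set c" "i < length c" "E y (c ! i)"
  shows "length c = 2 * k - 2" "deg C y = k - 1"
    "{w\<in>C. E y w} = {c ! ((i + j) mod (2 * k - 2)) | j. j < 2 * k - 2 \<and> even j}"
proof -
  have c0: "c \<noteq> []" using c by (auto simp: is_cyc_def)
  obtain p q where pq: "rotate i c = p # q" using c0 by (metis list.exhaust rotate_is_Nil_conv)
  have pi: "p = c ! i" using pq y(2) c0 by (metis hd_rotate_conv_nth list.sel(1) mod_less)
  have spq: "set (p # q) = set c" "length (p # q) = length c" using pq by (metis set_rotate, metis length_rotate)
  have cyc: "is_cyc C (p # q)" using is_cyc_rotate[OF c, of i] pq by simp
  define P where "P ds \<longleftrightarrow> is_path (C - set c) ds \<and> ds \<noteq> [] \<and> hd ds = y" for ds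
  have "P [y]" using y by (auto simp: P_def is_path_def)
  then obtain ds where ds: "P ds" "\<And>zs. P zs \<Longrightarrow> length zs \<le> length ds"
    using ex_longest_path[of "C - set c" P "[y]"] C unfolding P_def by blast
  have dmax: "\<not> E (last ds) w" if w: "w \<in> C - set c - set ds" for w
  proof
    assume "E (last ds) w"
    hence "P (ds @ [w])" using ds(1) w by (auto simp: P_def is_path_def successively_append_iff)
    thus False using ds(2) by fastforce
  qed
  have D: "is_path (C - set (p # q)) ds" "ds \<noteq> []" "E p (hd ds)"
    using ds(1) y(3) pi spq by (auto simp: P_def E_sym)
  have cmax': "\<forall>c'. is_cyc C c' \<longrightarrow> length c' \<le> length (p # q)"
    using cmax unfolding spq .
  have dmax': "\<forall>w\<in>C - set (p # q) - set ds. \<not> E (last ds) w"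
    using dmax unfolding spq by blast
  have clen': "length (p # q) \<ge> k + 1" using clen spq by simp
  note gap = longest_cycle_gap[where k = k, OF C cyc cmax' clen' nopath mindeg D dmax']
  have len: "length ds = 1" by (rule gap(1))
  have l: "last ds = y" using ds(1) len by (cases ds) (auto simp: P_def)
  show lc: "length c = 2 * k - 2" using gap(2) spq(2) by simp
  show "deg C y = k - 1" using gap(3) unfolding l .
  have N: "{w\<in>C. E y w} = {(p # q) ! j | j. j < 2 * k - 2 \<and> even j}" using gap(4) unfolding l .
  have "(p # q) ! j = c ! ((i + j) mod (2 * k - 2))" if "j < 2 * k - 2" for j
    using nth_rotate[of j c i] lc pq that by simp
  thus "{w\<in>C. E y w} = {c ! ((i + j) mod (2 * k - 2)) | j. j < 2 * k - 2 \<and> even j}"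
    unfolding N setcompr_eq_image by (intro image_cong) auto
qed

lemma even_shift_mod:
  fixes i n :: nat
  assumes "even n" "n > 0" "even i"
  shows "{(i + j) mod n | j. j < n \<and> even j} = {j. j < n \<and> even j}"
proof (intro equalityI subsetI)
  fix t assume "t \<in> {(i + j) mod n | j. j < n \<and> even j}"
  then obtain j where "t = (i + j) mod n" "even j" by auto
  thus "t \<in> {j. j < n \<and> even j}" using assms by (simp add: dvd_mod_iff)
next
  fix t assume t: "t \<in> {j. j < n \<and> even j}"
  \<comment> \<open>The summand \<open>n * i\<close> keeps the subtraction of \<open>i\<close> from
    being truncated and, \<open>n\<close> being even, does not affect parity.\<close>
  define j where "j = (t + n * i - i) mod n"
  have ge: "i \<le> n * i" using assms(2) by simp
  hence "even (t + n * i - i)" using t assms by simp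
  hence "even j" "j < n" using assms by (simp_all add: j_def dvd_mod_iff)
  moreover have "(i + j) mod n = (i + (t + n * i - i)) mod n"
    by (simp add: j_def mod_add_right_eq)
  moreover have "i + (t + n * i - i) = t + n * i" using ge by linarith
  ultimately show "t \<in> {(i + j) mod n | j. j < n \<and> even j}" using t by force
qed

text \<open>Replacing a cycle vertex at an odd position by an outside vertex \<open>y\<close> gives another longest
  cycle, so the replaced vertex has the same neighbours as \<open>y\<close>.\<close>

lemma long_cycle_structure:
  assumes C: "finite C" "connected_in C" "card C \<ge> 2 * k"
    and nopath: "\<forall>xs. is_path C xs \<longrightarrow> length xs < 2 * k"
    and mindeg: "\<forall>v\<in>C. k \<le> deg C v + 1"
    and c0: "is_cyc C c0" "length c0 \<ge> k + 1"
  shows "\<exists>A\<subseteq>C. card A = k - 1 \<and> (\<forall>v\<in>C - A. {w\<in>C. E v w} = A)"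
proof -
  obtain c1 where c1: "is_cyc C c1" "\<And>zs. is_cyc C zs \<Longrightarrow> length zs \<le> length c1"
    using ex_longest_path[of C "is_cyc C" c0] C(1) c0(1) by (auto simp: is_cyc_def)
  have cmax1: "\<forall>c'. is_cyc C c' \<longrightarrow> length c' \<le> length c1" using c1 by blast
  have len1: "length c1 \<ge> k + 1" using c1(2)[OF c0(1)] c0(2) by simp
  have sc1: "set c1 \<subseteq> C" "distinct c1" using c1 by (auto simp: is_cyc_def is_path_def)
  have ne1: "set c1 \<noteq> {}" using c1(1) by (auto simp: is_cyc_def)
  have "length c1 < 2 * k" using c1(1) nopath by (auto simp: is_cyc_def)
  hence "set c1 \<noteq> C" using C(3) sc1 by (metis distinct_card not_less)
  then obtain z y where zy: "z \<in> set c1" "y \<in> C - set c1" "E z y"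
    using connected_inD[OF C(2) sc1(1) ne1] by blast
  then obtain i where i: "i < length c1" "z = c1 ! i" by (metis in_set_conv_nth)
  define c where "c = rotate i c1"
  have c: "is_cyc C c" using is_cyc_rotate[OF c1(1)] by (simp add: c_def)
  have lc: "length c = length c1" "set c = set c1" by (simp_all add: c_def)
  have cmax: "\<forall>c'. is_cyc C c' \<longrightarrow> length c' \<le> length c" using cmax1 lc by simp
  have len: "length c \<ge> k + 1" using len1 lc by simp
  have y: "y \<in> C - set c" "0 < length c" "E y (c ! 0)"
    using zy i nth_rotate[of 0 c1 i] by (cases "c1 = []"; auto simp: c_def E_sym)+
  note out = longest_cycle_outside[OF C(1) c cmax len nopath mindeg]
  have n: "length c = 2 * k - 2" by (rule out(1)[OF y])
  define A where "A = {c ! j | j. j < 2 * k - 2 \<and> even j}"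
  have n0: "2 * k - 2 > 0" using n y(2) by simp
  have modA: "{c' ! ((i + j) mod (2 * k - 2)) | j. j < 2 * k - 2 \<and> even j}
      = {c' ! j | j. j < 2 * k - 2 \<and> even j}" if "even i" for i and c' :: "'a list"
  proof -
    have "{c' ! ((i + j) mod (2 * k - 2)) | j. j < 2 * k - 2 \<and> even j}
        = (!) c' ` {(i + j) mod (2 * k - 2) | j. j < 2 * k - 2 \<and> even j}" by auto
    also have "\<dots> = {c' ! j | j. j < 2 * k - 2 \<and> even j}"
      using even_shift_mod[of "2 * k - 2" i] that n0 by auto
    finally show ?thesis .
  qed
  have yA: "{w\<in>C. E y w} = A"
    using out(3)[OF y] modA[of 0 c] by (simp add: A_def)
  have cA: "card A = k - 1" using out(2)[OF y] yA by (simp add: deg_def)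
  have AC: "A \<subseteq> set c" using n by (auto simp: A_def)
  have odd_nbrs: "{w\<in>C. E (c ! j) w} = A" if j: "j < length c" "odd j" for j
  proof -
    define c' where "c' = c[j := y]"
    have l': "length c' = length c" by (simp add: c'_def)
    have dc: "distinct c" "set c \<subseteq> C" "successively E c" "E (last c) (hd c)" "length c \<ge> 3"
      using c by (auto simp: is_cyc_def is_path_def)
    have yn: "E y (c ! l)" "E (c ! l) y" if "l < length c" "even l" for l
    proof -
      have "c ! l \<in> A" using that n by (auto simp: A_def)
      thus "E y (c ! l)" using yA by auto
      thus "E (c ! l) y" by (rule E_sym)
    qed
    have "successively E c'"
      unfolding successively_conv_nth
    proof (intro allI impI)
      fix l assume l: "Suc l < length c'"
      consider "l = j" | "Suc l = j" | "l \<noteq> j" "Suc l \<noteq> j" by blast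
      thus "E (c' ! l) (c' ! Suc l)"
      proof cases
        case 1
        thus ?thesis using yn[of "Suc l"] j l l' by (simp add: c'_def)
      next
        case 2
        thus ?thesis using yn[of l] j l l' by (auto simp: c'_def)
      next
        case 3
        thus ?thesis using dc(3) l l' by (simp add: c'_def successively_conv_nth)
      qed
    qed
    moreover have "distinct c'" using dc y by (simp add: c'_def distinct_list_update)
    moreover have "set c' \<subseteq> C" using set_update_subset_insert[of c j y] dc y by (auto simp: c'_def)
    moreover have "E (last c') (hd c')"
    proof -
      have cn: "c \<noteq> []" "c' \<noteq> []" using dc l' by auto
      have h: "hd c' = c ! 0" using j cn by (auto simp: c'_def hd_conv_nth nth_list_update odd_pos)
      have "last c' = c' ! (length c - 1)" using cn l' by (simp add: last_conv_nth)
      hence "last c' = last c \<or> last c' = y" using cn j by (auto simp: c'_def nth_list_update last_conv_nth)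
      thus ?thesis using h dc(4) y(3) cn by (auto simp: hd_conv_nth)
    qed
    ultimately have cyc': "is_cyc C c'" using dc l' by (simp add: is_cyc_def is_path_def)
    have j1: "j - 1 < length c'" "even (j - 1)" "j - 1 \<noteq> j" "Suc (j - 1) = j" using j l' by (auto elim: oddE)
    have o: "c ! j \<in> C - set c'"
    proof -
      have "c ! j \<notin> set c'"
      proof
        assume "c ! j \<in> set c'"
        then obtain l where l: "l < length c'" "c ! j = c' ! l" by (metis in_set_conv_nth)
        show False
        proof (cases "l = j")
          case True
          thus ?thesis using l j y by (auto simp: c'_def)
        next
          case False
          thus ?thesis using l j dc(1) by (auto simp: c'_def nth_eq_iff_index_eq)
        qed
      qed
      thus ?thesis using j dc by auto
    qed
    have E1: "E (c ! j) (c' ! (j - 1))"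
    proof -
      have "E (c ! (j - 1)) (c ! Suc (j - 1))" by (rule successively_nth[OF dc(3)]) (simp only: j1(4) j(1))
      thus ?thesis using j1 by (simp add: c'_def E_sym)
    qed
    have cm': "\<forall>d. is_cyc C d \<longrightarrow> length d \<le> length c'" using cmax l' by simp
    have ln': "k + 1 \<le> length c'" using len l' by simp
    have "{w\<in>C. E (c ! j) w} = {c' ! j | j. j < 2 * k - 2 \<and> even j}"
      using longest_cycle_outside(3)[OF C(1) cyc' cm' ln' nopath mindeg o j1(1) E1] modA[OF j1(2), of c'] by simp
    also have "\<dots> = A"
    proof -
      have "c' ! l = c ! l" if "even l" for l using that j(2) by (cases "l = j") (auto simp: c'_def)
      thus ?thesis unfolding A_def by (metis (mono_tags, lifting))
    qed
    finally show ?thesis .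
  qed
  have outside: "{w\<in>C. E v w} = A" if v: "v \<in> C - set c" "w \<in> set c" "E v w" for v w
  proof -
    obtain j where j: "j < length c" "w = c ! j" using v by (metis in_set_conv_nth)
    have Ej: "E v (c ! j)" using v j by simp
    have "even j"
    proof (rule ccontr)
      assume "odd j"
      hence "v \<in> A" using odd_nbrs[OF j(1)] Ej v by (auto simp: E_sym)
      thus False using AC v by auto
    qed
    thus ?thesis using out(3)[OF v(1) j(1) Ej] modA[of j c] by (simp add: A_def)
  qed
  have AC': "A \<subseteq> C" using AC sc1 lc by auto
  \<comment> \<open>An edge leaving \<open>B\<close> starts in \<open>A\<close>, because all other
    members of \<open>B\<close> have their neighbours in \<open>A\<close>; its other end then has
    neighbourhood \<open>A\<close> too. So \<open>B\<close> is closed, and connectedness gives all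
    of \<open>C\<close>.\<close>
  define B where "B = A \<union> {v\<in>C. {w\<in>C. E v w} = A}"
  have "B = C"
  proof (rule ccontr)
    assume ne: "B \<noteq> C"
    have "B \<subseteq> C" "B \<noteq> {}" using AC' yA y by (auto simp: B_def)
    then obtain v w where vw: "v \<in> B" "w \<in> C - B" "E v w" using connected_inD[OF C(2) _ _ ne] by blast
    have "v \<in> A" using vw AC' by (auto simp: B_def)
    show False
    proof (cases "w \<in> set c")
      case True
      then obtain j where j: "j < length c" "w = c ! j" by (metis in_set_conv_nth)
      show False
      proof (cases "even j")
        case True
        hence "w \<in> A" using j n by (auto simp: A_def)
        thus False using vw by (auto simp: B_def)
      next
        case False
        thus False using odd_nbrs[of j] j vw by (auto simp: B_def)
      qed
    next
      case False
      hence "{u\<in>C. E w u} = A" using outside[of w v] vw \<open>v \<in> A\<close> AC by (auto simp: E_sym)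
      thus False using vw by (auto simp: B_def)
    qed
  qed
  hence "\<forall>v\<in>C - A. {w\<in>C. E v w} = A" by (auto simp: B_def)
  thus ?thesis using cA AC' by blast
qed

section \<open>Graphs without cycles on more than k vertices, and stars\<close>

lemma ex_low_degree:
  assumes X: "finite X" "X \<noteq> {}" and k: "k \<ge> 2"
    and cyc: "\<forall>c. is_cyc X c \<longrightarrow> length c \<le> k"
  shows "\<exists>v\<in>X. deg X v < k"
proof -
  obtain v where v: "v \<in> X" using X by blast
  have "is_path X [v]" using v by (simp add: is_path_def)
  then obtain xs where xs: "is_path X xs" "\<And>zs. is_path X zs \<Longrightarrow> length zs \<le> length xs"
    using ex_longest_path[of X "is_path X" "[v]"] X(1) by blast
  have xs0: "xs \<noteq> []" using xs(2)[OF \<open>is_path X [v]\<close>] by auto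
  define y where "y = hd xs"
  have yX: "y \<in> X" using xs xs0 by (auto simp: y_def is_path_def)
  \<comment> \<open>All neighbours of the end of a longest path lie on it, and one at position k or
    later would close a cycle on more than k vertices.\<close>
  have "{w\<in>X. E y w} \<subseteq> (!) xs ` {1..<k}"
  proof
    fix w assume "w \<in> {w\<in>X. E y w}"
    hence w: "w \<in> X" "E y w" by auto
    have "w \<in> set xs"
    proof (rule ccontr)
      assume "w \<notin> set xs"
      hence "is_path X (w # xs)" using xs(1) w by (auto simp: is_path_def successively_Cons y_def E_sym)
      thus False using xs(2) by fastforce
    qed
    then obtain j where j: "j < length xs" "w = xs ! j" by (metis in_set_conv_nth)
    have j0: "j \<noteq> 0" using j w E_irrefl[of y] xs0 by (metis hd_conv_nth y_def)
    have "j < k"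
    proof (rule ccontr)
      assume jk: "\<not> j < k"
      have "successively E (take (Suc j) xs)"
        using xs(1) append_take_drop_id[of "Suc j" xs] by (metis is_path_def successively_append_iff)
      moreover have "last (take (Suc j) xs) = w" "hd (take (Suc j) xs) = y"
        using j xs0 by (auto simp: take_Suc_conv_app_nth hd_append y_def hd_conv_nth)
      moreover have "set (take (Suc j) xs) \<subseteq> X" using xs(1) set_take_subset[of "Suc j" xs] by (auto simp: is_path_def)
      ultimately have "is_cyc X (take (Suc j) xs)"
        using xs(1) w k j jk by (auto simp: is_cyc_def is_path_def E_sym simp del: take_Suc)
      hence "length (take (Suc j) xs) \<le> k" using cyc by blast
      thus False using j jk by simp
    qed
    thus "w \<in> (!) xs ` {1..<k}" using j j0 by (intro image_eqI[of _ _ j]) auto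
  qed
  hence "card {w\<in>X. E y w} \<le> card ((!) xs ` {1..<k})" by (intro card_mono) auto
  also have "\<dots> \<le> card {1..<k}" by (rule card_image_le) simp
  finally have "deg X y < k" using k by (simp add: deg_def)
  thus ?thesis using yX by blast
qed

text \<open>For \<open>k = 2\<close> stars attain the bound, so the strict inequality needs \<open>k \<ge> 3\<close>.\<close>

lemma ecount_short_cycles:
  assumes "finite X" "k \<ge> 3" "\<forall>c. is_cyc X c \<longrightarrow> length c \<le> k" "card X \<ge> k + 1"
  shows "ecount X < (real k - 1) * card X - real k * (real k - 1) / 2"
  using assms
proof (induction "card X" arbitrary: X rule: less_induct)
  case less
  have "X \<noteq> {}" using less by auto
  then obtain v where v: "v \<in> X" "deg X v < k" using ex_low_degree[of X k] less by auto
  have ec: "ecount X = ecount (X - {v}) + deg X v" by (rule ecount_remove) (use less v in auto)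
  have dv: "real (deg X v) \<le> real k - 1" using v(2) by linarith
  have cX: "real (card (X - {v})) = real (card X) - 1"
    using less v by (simp add: of_nat_diff card_gt_0_iff Suc_leI)
  show ?case
  proof (cases "card X = k + 1")
    case False
    have "ecount (X - {v}) < (real k - 1) * card (X - {v}) - real k * (real k - 1) / 2"
    proof (rule less(1))
      show "\<forall>c. is_cyc (X - {v}) c \<longrightarrow> length c \<le> k"
        using less(4) unfolding is_cyc_def is_path_def by blast
    qed (use less v False in \<open>auto simp: card_gt_0_iff\<close>)
    thus ?thesis using ec dv cX by (simp add: algebra_simps)
  next
    case True
    show ?thesis
    proof (rule ccontr)
      assume less_not: "\<not> ?thesis"
      have "real (card X) = real k + 1" using True by simp
      hence "ecount X \<ge> (real k - 1) * (real k + 1) - real k * (real k - 1) / 2"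
        using less_not by (simp only: not_less)
      \<comment> \<open>On k + 1 vertices, so many edges force \<open>X - {v}\<close> to be complete
        and \<open>v\<close> to have at least two neighbours; a Hamiltonian path between these
        closes up through \<open>v\<close> to a cycle on k + 1 vertices.\<close>
      hence big: "ecount (X - {v}) + deg X v \<ge> (real k - 1) * real k / 2 + (real k - 1)"
        unfolding ec by (simp add: field_simps)
      have cXk: "card (X - {v}) = k" using True v less by simp
      have fX: "finite (X - {v})" using less by simp
      have "ecount (X - {v}) \<ge> real (card (X - {v})) * (real (card (X - {v})) - 1) / 2"
        using big dv cXk by (simp add: field_simps)
      hence full: "E a b" if "a \<in> X - {v}" "b \<in> X - {v}" "a \<noteq> b" for a b
        using ecount_eq_complete[OF fX _ that] by blast
      have "deg X v \<ge> 2"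
        using big ecount_le[OF fX] cXk less(3) by (simp add: field_simps)
      then obtain T where "T \<subseteq> {w\<in>X. E v w}" "card T = 2"
        unfolding deg_def by (metis obtain_subset_with_card_n)
      then obtain a b where ab: "a \<in> {w\<in>X. E v w}" "b \<in> {w\<in>X. E v w}" "a \<noteq> b"
        by (auto simp: card_2_iff)
      have ab': "a \<in> X - {v}" "b \<in> X - {v}" using ab E_irrefl by auto
      have fl: "(\<forall>p\<in>X - {v} - {a, b}. deg (X - {v}) p = card (X - {v}) - 1) \<or>
         card (X - {v}) * (real (card (X - {v})) - 1) - 2 * ecount (X - {v}) + 3 \<le> card (X - {v})"
        using full deg_full_iff[OF fX] by auto
      have c3: "3 \<le> card (X - {v})" using cXk less(3) by simp
      obtain xs where xs: "is_path (X - {v}) xs" "set xs = X - {v}" "hd xs = a" "last xs = b"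
        using hamilton_connected[OF fX ab' ab(3) c3 fl] by blast
      have "length xs = k" using xs cXk by (metis distinct_card is_path_def)
      moreover have "distinct xs" "successively E xs" "E v (hd xs)" "E (last xs) v" "insert v (set xs) = X" "v \<notin> set xs"
        using xs ab v E_commute by (auto simp: is_path_def)
      ultimately have "is_cyc X (v # xs)" using less(3)
        by (auto simp: is_cyc_def is_path_def successively_Cons)
      thus False using less(4) \<open>length xs = k\<close> by fastforce
    qed
  qed
qed

text \<open>A vertex with two neighbours must see everything, since an edge leaving its closed
  neighbourhood would extend to a path on four vertices. An edge between two leaves would do so as
  well, given a fourth vertex. This settles k = 2, where no strict edge bound is available.\<close>

lemma star_structure:
  assumes C: "finite C" "connected_in C" "card C \<ge> 4"
    and nopath: "\<forall>xs. is_path C xs \<longrightarrow> length xs < 4"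
  shows "\<exists>a\<in>C. \<forall>v\<in>C - {a}. {w\<in>C. E v w} = {a}"
proof -
  have np: False if "E a b" "E b c" "E c d" "distinct [a, b, c, d]" "{a, b, c, d} \<subseteq> C" for a b c d
    using nopath[rule_format, of "[a, b, c, d]"] that by (auto simp: is_path_def)
  have more: "\<exists>z. z \<in> C - S" if "card S < 4" "finite S" for S
    using that C(3) by (metis card_mono Diff_eq_empty_iff ex_in_conv not_less order_trans)
  obtain u where u: "u \<in> C" using C(2) by (auto simp: connected_in_def)
  have "{u} \<noteq> C" using more[of "{u}"] by auto
  then obtain v where v: "v \<in> C - {u}" "E u v" using connected_inD[OF C(2), of "{u}"] u by blast
  have "{u, v} \<noteq> C" using more[of "{u, v}"] v by (auto simp: card_insert_if)
  then obtain t w where tw: "t \<in> {u, v}" "w \<in> C - {u, v}" "E t w"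
    using connected_inD[OF C(2), of "{u, v}"] u v by blast
  obtain a b where ab: "E a b" "E a w" "{a, b} = {u, v}" "a \<noteq> b" "w \<noteq> a" "w \<noteq> b" "a \<in> C" "b \<in> C" "w \<in> C"
  proof (cases "t = u")
    case True
    thus thesis using that[of u v] v u tw by auto
  next
    case False
    thus thesis using that[of v u] v u tw by (auto simp: E_sym insert_commute)
  qed
  have all: "E a z" if z: "z \<in> C - {a}" for z
  proof (rule ccontr)
    assume nz: "\<not> E a z"
    define B where "B = insert a {z\<in>C. E a z}"
    have "B \<subseteq> C" "B \<noteq> {}" "B \<noteq> C" using nz z ab by (auto simp: B_def)
    then obtain s r where sr: "s \<in> B" "r \<in> C - B" "E s r" using connected_inD[OF C(2)] by blast
    have s: "E a s" "s \<in> C" "s \<noteq> a" "r \<noteq> a" "r \<noteq> s" using sr ab E_irrefl by (auto simp: B_def)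
    obtain t where t: "E a t" "t \<noteq> s" "t \<in> C" "t \<noteq> a" using ab by metis
    have "r \<noteq> t" using sr t by (auto simp: B_def)
    thus False using np[of r s a t] sr s t ab(7) by (auto simp: E_sym)
  qed
  have "{w\<in>C. E z w} = {a}" if z: "z \<in> C - {a}" for z
  proof (intro equalityI subsetI)
    fix y assume y: "y \<in> {w\<in>C. E z w}"
    show "y \<in> {a}"
    proof (rule ccontr)
      assume ya: "y \<notin> {a}"
      obtain t where t: "t \<in> C - {a, y, z}" using more[of "{a, y, z}"] card_length[of "[a, y, z]"] by auto
      have "z \<noteq> y" using y E_irrefl by auto
      thus False using np[of z y a t] y ya z t all[of y] all[of t] ab by (auto simp: E_sym)
    qed
  qed (use all[OF z] ab in \<open>auto simp: E_sym\<close>)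
  thus ?thesis using ab by blast
qed

text \<open>A cycle on more than k vertices forces the join; without one there are too few
  edges.\<close>

lemma large_component_structure:
  assumes C: "finite C" "connected_in C" "card C \<ge> 2 * k" and k: "k \<ge> 2"
    and nopath: "\<forall>xs. is_path C xs \<longrightarrow> length xs < 2 * k"
    and mindeg: "\<forall>v\<in>C. k \<le> deg C v + 1"
  shows "(\<exists>A\<subseteq>C. card A = k - 1 \<and> (\<forall>v\<in>C - A. {w\<in>C. E v w} = A)) \<or>
    ecount C < (real k - 1) * card C - real k * (real k - 1) / 2"
proof (cases "k = 2")
  case True
  then obtain a where "a \<in> C" "\<forall>v\<in>C - {a}. {w\<in>C. E v w} = {a}"
    using star_structure[of C] C nopath by auto
  thus ?thesis using True by (intro disjI1 exI[of _ "{a}"]) auto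
next
  case False
  show ?thesis
  proof (cases "\<forall>c. is_cyc C c \<longrightarrow> length c \<le> k")
    case True
    thus ?thesis using ecount_short_cycles[of C k] C k False by auto
  next
    case False
    then obtain c where "is_cyc C c" "length c \<ge> k + 1" by (auto simp: not_le)
    thus ?thesis using long_cycle_structure[OF C nopath mindeg] by blast
  qed
qed

section \<open>Components and the weight \<open>\<eta>\<close>\<close>

definition separated :: "'a set \<Rightarrow> 'a set \<Rightarrow> bool" where
  "separated A B \<longleftrightarrow> A \<inter> B = {} \<and> (\<forall>v\<in>A. \<forall>w\<in>B. \<not> E v w)"

definition component_of :: "'a set \<Rightarrow> 'a set \<Rightarrow> bool" where
  "component_of U C \<longleftrightarrow> C \<subseteq> U \<and> connected_in C \<and> separated C (U - C)"

text \<open>A nonempty set of least size with no edge to the rest is connected: a cut inside it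
  would give a smaller such set.\<close>

lemma ex_component:
  assumes "finite U" "U \<noteq> {}"
  shows "\<exists>C. component_of U C"
proof -
  define P where "P B \<longleftrightarrow> B \<subseteq> U \<and> B \<noteq> {} \<and> separated B (U - B)" for B
  have "P U" using assms by (auto simp: P_def separated_def)
  then obtain C where C: "P C" "\<And>B. P B \<Longrightarrow> card C \<le> card B"
    using ex_has_least_nat[of P U card] by blast
  have fC: "finite C" using C(1) assms finite_subset unfolding P_def by blast
  have "B = C" if B: "B \<subseteq> C" "B \<noteq> {}" "\<forall>v\<in>B. \<forall>w\<in>C - B. \<not> E v w" for B
  proof -
    have "\<not> E v w" if "v \<in> B" "w \<in> U - B" for v w
      using B C(1) that unfolding P_def separated_def by blast
    hence "P B" using B C(1) by (auto simp: P_def separated_def)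
    hence "card C \<le> card B" by (rule C(2))
    thus ?thesis using B fC by (meson card_seteq)
  qed
  hence "connected_in C" using C(1) unfolding connected_in_def P_def by blast
  thus ?thesis using C(1) by (auto simp: component_of_def P_def)
qed

lemma component_of_Diff:
  assumes "component_of U C" "component_of (U - C) D"
  shows "component_of U D"
proof -
  have "\<not> E v w" if "v \<in> D" "w \<in> C" for v w
    using assms that E_sym unfolding component_of_def separated_def by blast
  thus ?thesis using assms unfolding component_of_def separated_def by blast
qed

text \<open>Components are split off one at a time, so that sums over the family of all components
  never appear.\<close>

lemma component_additive_nonpos:
  fixes f :: "'a set \<Rightarrow> real"
  assumes "finite U" "f {} = 0"
    and add: "\<forall>A B. finite A \<and> finite B \<and> separated A B \<longrightarrow> f (A \<union> B) = f A + f B"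
    and "\<forall>C. component_of U C \<longrightarrow> f C \<le> 0"
  shows "f U \<le> 0"
  using assms(1,4)
proof (induction "card U" arbitrary: U rule: less_induct)
  case less
  show ?case
  proof (cases "U = {}")
    case False
    then obtain C where C: "component_of U C" using ex_component less by blast
    have CU: "C \<subseteq> U" "C \<noteq> {}" "separated C (U - C)"
      using C by (auto simp: component_of_def connected_in_def)
    have "card (U - C) < card U" using CU less by (intro psubset_card_mono) auto
    moreover have "\<forall>D. component_of (U - C) D \<longrightarrow> f D \<le> 0"
      using component_of_Diff[OF C] less(3) by blast
    ultimately have "f (U - C) \<le> 0" using less by simp
    moreover have "f (C \<union> (U - C)) = f C + f (U - C)"
      using add CU less(2) finite_subset by blast
    moreover have "C \<union> (U - C) = U" using CU by blast
    ultimately show ?thesis using less(3) C by fastforce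
  qed (use assms in simp)
qed

section \<open>The weight \<open>eta\<close>: additivity, passage to the core, deficit\<close>

definition eta :: "nat \<Rightarrow> ('a \<Rightarrow> real) \<Rightarrow> 'a set \<Rightarrow> real" where
  "eta k x U = (\<Sum>v\<in>U. (real (deg U v) - real k + 1) * x v) - ecount U"

lemma separated_deg:
  assumes "separated A B" "finite A" "finite B"
  shows "v \<in> A \<Longrightarrow> deg B v = 0" "v \<in> B \<Longrightarrow> deg A v = 0"
    "v \<in> A \<Longrightarrow> deg (A \<union> B) v = deg A v" "v \<in> B \<Longrightarrow> deg (A \<union> B) v = deg B v"
proof -
  have AB: "A \<inter> B = {}" using assms by (auto simp: separated_def)
  show 1: "v \<in> A \<Longrightarrow> deg B v = 0" using assms by (auto simp: separated_def deg_def)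
  show 2: "v \<in> B \<Longrightarrow> deg A v = 0" using assms E_sym[of v] by (auto simp: separated_def deg_def)
  show "v \<in> A \<Longrightarrow> deg (A \<union> B) v = deg A v" using 1 deg_Un[OF assms(2,3) AB] by simp
  show "v \<in> B \<Longrightarrow> deg (A \<union> B) v = deg B v" using 2 deg_Un[OF assms(2,3) AB] by simp
qed

lemma eta_Un:
  assumes "separated A B" "finite A" "finite B"
  shows "eta k x (A \<union> B) = eta k x A + eta k x B"
proof -
  have AB: "A \<inter> B = {}" using assms by (auto simp: separated_def)
  have e: "ecount (A \<union> B) = ecount A + ecount B"
    using ecount_Un[OF assms(2,3) AB] separated_deg(2)[OF assms] by simp
  show ?thesis
    unfolding eta_def e sum.union_disjoint[OF assms(2,3) AB]
    using separated_deg(3,4)[OF assms] by simp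
qed

text \<open>Deleting a vertex whose degree is too small never decreases \<^term>\<open>eta\<close>, even after
  paying the weight of that vertex.\<close>

lemma ex_min_degree_core:
  assumes "finite N" "\<forall>v\<in>N. 0 \<le> x v \<and> x v \<le> 1"
  shows "\<exists>U\<subseteq>N. (\<forall>v\<in>U. k \<le> deg U v + 1) \<and> eta k x N \<le> eta k x U - sum x (N - U)"
  using assms
proof (induction "card N" arbitrary: N rule: less_induct)
  case less
  show ?case
  proof (cases "\<forall>v\<in>N. k \<le> deg N v + 1")
    case True
    thus ?thesis by (intro exI[of _ N]) auto
  next
    case False
    then obtain v where v: "v \<in> N" "deg N v + 1 < k" by auto
    let ?M = "N - {v}"
    have f: "finite ?M" using less by simp
    have dw: "real (deg N w) = real (deg ?M w) + (if E v w then 1 else 0)" if "w \<in> ?M" for w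
    proof -
      have "deg (?M \<union> {v}) w = deg ?M w + deg {v} w" by (rule deg_Un) (use f in auto)
      moreover have "?M \<union> {v} = N" using v by auto
      moreover have "deg {v} w = (if E v w then 1 else 0)"
        unfolding deg_def using E_commute by (auto simp: Collect_conv_if cong: conj_cong)
      ultimately show ?thesis by simp
    qed
    have "(\<Sum>w\<in>N. (real (deg N w) - real k + 1) * x w)
        = (real (deg N v) - real k + 1) * x v + (\<Sum>w\<in>?M. (real (deg N w) - real k + 1) * x w)"
      using less v by (simp add: sum.remove)
    also have "(\<Sum>w\<in>?M. (real (deg N w) - real k + 1) * x w)
        = (\<Sum>w\<in>?M. (real (deg ?M w) - real k + 1) * x w + (if E v w then x w else 0))"
      by (intro sum.cong) (auto simp: dw algebra_simps)
    also have "\<dots> = (\<Sum>w\<in>?M. (real (deg ?M w) - real k + 1) * x w) + (\<Sum>w\<in>{w\<in>?M. E v w}. x w)"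
      by (simp only: sum.distrib sum.inter_filter[OF f])
    \<comment> \<open>The degrees lost by the neighbours of \<open>v\<close> cost at most
      \<open>deg N v\<close>, which is just what \<open>ecount\<close> loses with
      \<open>v\<close>.\<close>
    also have "(\<Sum>w\<in>{w\<in>?M. E v w}. x w) \<le> (\<Sum>w\<in>{w\<in>?M. E v w}. 1)"
      by (rule sum_mono) (use less in auto)
    also have "\<dots> = real (deg N v)" using deg_remove_self[of N v] by (simp add: deg_def)
    finally have "eta k x N \<le> eta k x ?M + (real (deg N v) - real k + 1) * x v"
      using ecount_remove[of N v] less v by (simp add: eta_def)
    moreover have "(real (deg N v) - real k + 1) * x v \<le> (-1) * x v"
      by (rule mult_right_mono) (use v less in auto)
    ultimately have 1: "eta k x N \<le> eta k x ?M - x v" by simp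
    have "card ?M < card N" using less v by (meson card_Diff1_less)
    then obtain U where U: "U \<subseteq> ?M" "\<forall>v\<in>U. k \<le> deg U v + 1" "eta k x ?M \<le> eta k x U - sum x (?M - U)"
      using less(1)[of ?M] f less(3) by blast
    have "N - U = insert v (?M - U)" using U v by auto
    hence "sum x (N - U) = x v + sum x (?M - U)" using f by simp
    thus ?thesis using U 1 by (intro exI[of _ U]) auto
  qed
qed

text \<open>The coefficients sum to twice \<open>ecount C\<close> minus (k - 1) *
  \<open>card C\<close>, so this splits off the purely combinatorial part. On a core the remaining
  sum is nonnegative, and it vanishes only if \<open>x\<close> is 1 wherever the degree exceeds k -
  1.\<close>

lemma eta_deficit:
  assumes "finite C"
  shows "eta k x C = ecount C - (real k - 1) * card C
    - (\<Sum>v\<in>C. (real (deg C v) - real k + 1) * (1 - x v))"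
proof -
  have "(\<Sum>v\<in>C. (real (deg C v) - real k + 1) * x v)
      = (\<Sum>v\<in>C. (real (deg C v) - real k + 1) - (real (deg C v) - real k + 1) * (1 - x v))"
    by (intro sum.cong) (auto simp: algebra_simps)
  also have "\<dots> = 2 * ecount C - (real k - 1) * card C
      - (\<Sum>v\<in>C. (real (deg C v) - real k + 1) * (1 - x v))"
    by (simp add: sum_subtractf sum.distrib ecount_def algebra_simps)
  finally show ?thesis by (simp add: eta_def)
qed

lemma eta_le_ecount:
  assumes "finite C" "\<forall>v\<in>C. k \<le> deg C v + 1" "\<forall>v\<in>C. 0 \<le> x v \<and> x v \<le> 1"
  shows "eta k x C \<le> ecount C - (real k - 1) * card C"
proof -
  have "(\<Sum>v\<in>C. (real (deg C v) - real k + 1) * (1 - x v)) \<ge> 0"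
  proof (intro sum_nonneg mult_nonneg_nonneg)
    fix v assume v: "v \<in> C"
    hence "real k \<le> real (deg C v + 1)" using assms by (simp only: of_nat_le_iff)
    thus "0 \<le> real (deg C v) - real k + 1" by simp
  qed (use assms in auto)
  thus ?thesis using eta_deficit[OF assms(1), of k x] by simp
qed

lemma ecount_join_independent:
  assumes "finite C" "A \<subseteq> C" "\<forall>v\<in>C - A. {w\<in>C. E v w} = A"
  shows "ecount C = ecount A + real (card A) * (real (card C) - real (card A))"
proof -
  have fA: "finite A" using assms finite_subset by blast
  have dA: "deg A v = card A" if "v \<in> C - A" for v
  proof -
    have "{w\<in>A. E v w} = A" using assms that by blast
    thus ?thesis by (simp add: deg_def)
  qed
  have d0: "deg (C - A) v = 0" if "v \<in> C - A" for v
  proof -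
    have "{w\<in>C - A. E v w} = {}" using assms that by blast
    thus ?thesis by (simp only: deg_def card.empty)
  qed
  have "ecount (A \<union> (C - A)) = ecount A + ecount (C - A) + (\<Sum>v\<in>C - A. real (deg A v))"
    by (rule ecount_Un) (use assms fA in auto)
  moreover have "A \<union> (C - A) = C" using assms by auto
  moreover have "ecount (C - A) = 0" by (simp add: ecount_def d0)
  moreover have "(\<Sum>v\<in>C - A. real (deg A v)) = real (card A) * (real (card C) - real (card A))"
    using assms fA by (simp add: dA card_Diff_subset of_nat_diff card_mono)
  ultimately show ?thesis by simp
qed

text \<open>For the join the count falls short of the bound exactly by the number of edges missing
  inside \<open>A\<close>, so equality makes \<open>A\<close> complete.\<close>

lemma large_component_ecount:
  assumes C: "finite C" "connected_in C" "card C \<ge> 2 * k" and k: "k \<ge> 2"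
    and nopath: "\<forall>xs. is_path C xs \<longrightarrow> length xs < 2 * k"
    and mindeg: "\<forall>v\<in>C. k \<le> deg C v + 1"
  shows "ecount C \<le> (real k - 1) * card C - real k * (real k - 1) / 2"
    "ecount C = (real k - 1) * card C - real k * (real k - 1) / 2 \<Longrightarrow>
      \<exists>A\<subseteq>C. card A = k - 1 \<and> (\<forall>v\<in>C - A. {w\<in>C. E v w} = A) \<and> (\<forall>v\<in>A. \<forall>w\<in>A - {v}. E v w)"
proof -
  let ?b = "(real k - 1) * card C - real k * (real k - 1) / 2"
  consider (lt) "ecount C < ?b"
    | (join) A where "A \<subseteq> C" "card A = k - 1" "\<forall>v\<in>C - A. {w\<in>C. E v w} = A"
    using large_component_structure[OF C k nopath mindeg] by blast
  note cs = this
  have "ecount C \<le> ?b \<and> (ecount C = ?b \<longrightarrow>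
      (\<exists>A\<subseteq>C. card A = k - 1 \<and> (\<forall>v\<in>C - A. {w\<in>C. E v w} = A) \<and> (\<forall>v\<in>A. \<forall>w\<in>A - {v}. E v w)))"
    using cs
  proof cases
    case join
    have fA: "finite A" using C join finite_subset by blast
    have cA: "real (card A) = real k - 1" using join k by (simp add: of_nat_diff)
    have e: "ecount C = ecount A + (real k - 1) * (real (card C) - (real k - 1))"
      using ecount_join_independent[OF C(1) join(1,3)] cA by simp
    have le: "ecount A \<le> (real k - 1) * (real k - 2) / 2" using ecount_le[OF fA] cA by simp
    have id: "(real k - 1) * (real k - 2) / 2 + (real k - 1) * (real (card C) - (real k - 1)) = ?b"
      by (simp add: field_simps)
    have "E v w" if "ecount C = ?b" "v \<in> A" "w \<in> A - {v}" for v w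
    proof (rule ecount_eq_complete[OF fA])
      show "real (card A) * (real (card A) - 1) / 2 \<le> ecount A" using that e id cA by simp
    qed (use that in auto)
    thus ?thesis using le e id join by auto
  qed auto
  thus "ecount C \<le> ?b" "ecount C = ?b \<Longrightarrow>
      \<exists>A\<subseteq>C. card A = k - 1 \<and> (\<forall>v\<in>C - A. {w\<in>C. E v w} = A) \<and> (\<forall>v\<in>A. \<forall>w\<in>A - {v}. E v w)"
    by blast+
qed

end

section \<open>The neighbourhood of a vertex of maximum weight\<close>

text \<open>\<open>size_le\<close> is the spectral hypothesis after squaring. The absence of chorded
  cycles is cast in terms of \<open>u\<close> alone: 2k - 1 neighbours on a cycle through
  \<open>u\<close> give 2k - 3 chords, as two of the edges belong to the cycle.\<close>

locale extremal_setup = adjacency E for E :: "'a \<Rightarrow> 'a \<Rightarrow> bool" +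
  fixes V :: "'a set" and x :: "'a \<Rightarrow> real" and u :: 'a and r :: real and k :: nat
  assumes fin: "finite V" and E_V: "E v w \<Longrightarrow> v \<in> V"
    and x01: "v \<in> V \<Longrightarrow> 0 \<le> x v \<and> x v \<le> 1"
    and u: "u \<in> V" "x u = 1"
    and sub: "v \<in> V \<Longrightarrow> r * x v \<le> (\<Sum>w\<in>{w\<in>V. E v w}. x w)"
    and k2: "k \<ge> 2"
    and r_ge: "r \<ge> 7 / 4 * (real k)\<^sup>2 + 2 * real k"
    and size_le: "ecount V - real k * (real k - 1) / 2 \<le> r\<^sup>2 - (real k - 1) * r"
    and no_chorded: "is_cyc V c \<Longrightarrow> length c = 2 * k + 1 \<Longrightarrow> u \<in> set c \<Longrightarrow>
      card {w\<in>set c. E u w} < 2 * k - 1"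
begin

definition N :: "'a set" where "N = {w\<in>V. E u w}"
definition W :: "'a set" where "W = V - N - {u}"
definition s :: real where "s = real k * (real k - 1) / 2"
text \<open>Any constant that satisfies \<open>c_bounds\<close> and \<open>c * r > s\<close> would do.\<close>

definition c :: real where "c = 2 * (real k - 1) / (7 * real k)"

lemma real_k_ge_2: "real k \<ge> 2" using k2 by simp

lemma finN [simp]: "finite N" and finW [simp]: "finite W"
  using fin by (auto simp: N_def W_def)

lemma V_split: "insert u (N \<union> W) = V" "u \<notin> N" "u \<notin> W" "N \<inter> W = {}" "N \<subseteq> V" "W \<subseteq> V"
  using u E_irrefl by (auto simp: N_def W_def)

lemma finite_subN: "C \<subseteq> N \<Longrightarrow> finite C"
  by (erule finite_subset) simp

text \<open>The third bound controls the weight of \<open>W\<close>, the fourth lets small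
  components alone contradict the walk inequality, and the fifth yields weight at most 2 in
  \<open>eta_critical_component\<close>.\<close>

lemma r_bounds: "r > 0" "r \<ge> real k - 1" "real k * (real k - 1) \<le> r" "c * r > s"
  "5 * real k - 3 + s \<le> r"
proof -
  define K where "K = real k * real k"
  have K: "K \<ge> 2 * real k" using real_k_ge_2 by (simp add: K_def)
  have rK: "r \<ge> 7 / 4 * K + 2 * real k" using r_ge by (simp add: K_def power2_eq_square)
  show "r > 0" "r \<ge> real k - 1" using rK K real_k_ge_2 by linarith+
  have "real k * (real k - 1) = K - real k" by (simp add: K_def algebra_simps)
  thus "real k * (real k - 1) \<le> r" using rK K real_k_ge_2 by linarith
  \<comment> \<open>\<open>c\<close> times 7/4 * k^2 is exactly \<open>s\<close>; strictness comes
    from the term 2 * k.\<close>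
  have "c * (7 / 4 * (real k)\<^sup>2 + 2 * real k) = s + 4 / 7 * (real k - 1)"
    using real_k_ge_2 by (simp add: c_def s_def field_simps power2_eq_square)
  moreover have "c \<ge> 0" using real_k_ge_2 by (simp add: c_def)
  hence "c * (7 / 4 * (real k)\<^sup>2 + 2 * real k) \<le> c * r" by (intro mult_left_mono r_ge)
  ultimately have "s + 4 / 7 * (real k - 1) \<le> c * r" by (simp only:)
  thus "c * r > s" using real_k_ge_2 by (simp add: field_simps)
  have "0 \<le> (real k - 1)\<^sup>2" by simp
  hence "5 / 4 * (real k)\<^sup>2 - 5 / 2 * real k + 3 \<ge> 0" by (simp add: power2_eq_square algebra_simps)
  thus "5 * real k - 3 + s \<le> r" using r_ge by (simp add: s_def power2_eq_square field_simps)
qed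

text \<open>The second bound is for components with fewer than 2k - 1 vertices, the third for the
  number of missing edges that \<open>hamilton_connected\<close> tolerates, the fourth for the end
  of \<open>eta_critical_component\<close>.\<close>

lemma c_bounds: "c > 0" "c \<le> 1 / 2" "c * (2 * real k - 1) \<le> real k - 3 / 2"
  "(2 * real k + 1) * c + 2 * (real k - 1) \<le> (2 * real k - 1) * (real k - 1)"
proof -
  show "c > 0" "c \<le> 1 / 2" using real_k_ge_2 by (simp_all add: c_def field_simps)
  define K where "K = real k * real k"
  have K: "K \<ge> 2 * real k" using real_k_ge_2 by (simp add: K_def)
  have "2 * (real k - 1) * (2 * real k - 1) = 4 * K - 6 * real k + 2"
    "(real k - 3 / 2) * (7 * real k) = 7 * K - 21 / 2 * real k"
    by (simp_all add: K_def algebra_simps)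
  hence "2 * (real k - 1) * (2 * real k - 1) \<le> (real k - 3 / 2) * (7 * real k)" using K real_k_ge_2 by linarith
  thus "c * (2 * real k - 1) \<le> real k - 3 / 2"
    using real_k_ge_2 by (simp add: c_def pos_divide_le_eq)
  have "7 * real k * (2 * real k - 3) = 14 * K - 21 * real k" by (simp add: K_def algebra_simps)
  hence "4 * real k + 2 \<le> 7 * real k * (2 * real k - 3)" using K real_k_ge_2 by linarith
  hence "2 * (2 * real k + 1) / (7 * real k) \<le> 2 * real k - 3"
    using real_k_ge_2 by (simp add: field_simps)
  hence "(real k - 1) * (2 * (2 * real k + 1) / (7 * real k)) \<le> (real k - 1) * (2 * real k - 3)"
    by (rule mult_left_mono) (use real_k_ge_2 in simp)
  moreover have "(real k - 1) * (2 * (2 * real k + 1) / (7 * real k)) = (2 * real k + 1) * c"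
    using real_k_ge_2 by (simp add: c_def field_simps)
  ultimately show "(2 * real k + 1) * c + 2 * (real k - 1) \<le> (2 * real k - 1) * (real k - 1)"
    by (simp add: algebra_simps)
qed

lemma s_pos: "s > 0" using real_k_ge_2 by (simp add: s_def)

lemma sum_x_nonneg: "A \<subseteq> V \<Longrightarrow> sum x A \<ge> 0"
  using x01 by (intro sum_nonneg) auto

lemma sum_x_mono: "A \<subseteq> B \<Longrightarrow> B \<subseteq> V \<Longrightarrow> sum x A \<le> sum x B"
  using x01 fin finite_subset by (intro sum_mono2) auto

lemma sum_nbr: "A \<subseteq> V \<Longrightarrow> (\<Sum>v\<in>A. \<Sum>w\<in>{w\<in>V. E v w}. x w) = (\<Sum>w\<in>V. real (deg A w) * x w)"
  using sum_nbrs_swap_deg[of A V x] fin finite_subset by blast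

lemma sumN_ge: "sum x N \<ge> r"
  using sub[OF u(1)] u(2) by (simp add: N_def)

lemma sum_V: "(\<Sum>v\<in>V. f v) = f u + (\<Sum>v\<in>N. f v) + (\<Sum>v\<in>W. f v)" for f :: "'a \<Rightarrow> real"
proof -
  have "(\<Sum>v\<in>insert u (N \<union> W). f v) = f u + (\<Sum>v\<in>N. f v) + (\<Sum>v\<in>W. f v)"
    using V_split(2-4) by (simp add: sum.union_disjoint)
  thus ?thesis unfolding V_split(1) .
qed

lemma size_split: "ecount V = card N + ecount N + ecount W + (\<Sum>w\<in>W. real (deg N w))"
proof -
  have "deg V u = card N" by (simp add: deg_def N_def)
  moreover have "V - {u} = N \<union> W" using V_split by auto
  ultimately show ?thesis
    using ecount_remove[OF fin u(1)] ecount_Un[OF finN finW V_split(4)] by simp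
qed

text \<open>Sort the walks of length two from \<open>u\<close> by their ends: \<open>u\<close>
  accounts for \<open>card N\<close>, \<open>N\<close> for the degree sum in \<open>eta\<close>, and
  \<open>W\<close> for at most the edges between \<open>N\<close> and \<open>W\<close>. Each slack
  term measures one estimate: \<open>x\<close> \<le> 1 on \<open>W\<close>, \<open>r\<close> \<le>
  \<open>sum x N\<close>, and subharmonicity on \<open>N\<close>.\<close>

lemma eta_nbhd_ge:
  "eta k x N \<ge> - s + ecount W + (\<Sum>w\<in>W. real (deg N w) * (1 - x w))
    + (r - (real k - 1)) * (sum x N - r) + (\<Sum>v\<in>N. (\<Sum>w\<in>{w\<in>V. E v w}. x w) - r * x v)"
proof -
  define X where "X = sum x N"
  define T where "T = (\<Sum>v\<in>N. \<Sum>w\<in>{w\<in>V. E v w}. x w)"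
  define DN where "DN = (\<Sum>v\<in>N. real (deg N v) * x v)"
  define DW where "DW = (\<Sum>w\<in>W. real (deg N w) * x w)"
  define D where "D = (\<Sum>w\<in>W. real (deg N w))"
  have "deg N u = card N" unfolding deg_def N_def by (rule arg_cong[of _ _ card]) auto
  hence T: "T = card N + DN + DW"
    unfolding T_def sum_nbr[OF V_split(5)] sum_V by (simp add: u DN_def DW_def)
  have eta: "eta k x N = DN - (real k - 1) * X - ecount N"
    by (simp add: eta_def DN_def X_def algebra_simps sum.distrib sum_subtractf sum_distrib_left)
  have s2: "(\<Sum>v\<in>N. (\<Sum>w\<in>{w\<in>V. E v w}. x w) - r * x v) = T - r * X"
    by (simp add: T_def X_def sum_subtractf sum_distrib_left)
  have s3: "(\<Sum>w\<in>W. real (deg N w) * (1 - x w)) = D - DW"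
    by (simp add: D_def DW_def sum_subtractf algebra_simps)
  have "(r - (real k - 1)) * (X - r) + (T - r * X) = T - r\<^sup>2 + (real k - 1) * r - (real k - 1) * X"
    by (simp add: algebra_simps power2_eq_square)
  moreover have "card N + ecount N + ecount W + D - s \<le> r\<^sup>2 - (real k - 1) * r"
    using size_le size_split by (simp add: s_def D_def)
  ultimately show ?thesis
    unfolding eta s2 s3 X_def[symmetric] T by linarith
qed

lemma slacks_nonneg:
  "(\<Sum>w\<in>W. real (deg N w) * (1 - x w)) \<ge> 0" "(r - (real k - 1)) * (sum x N - r) \<ge> 0"
  "(\<Sum>v\<in>N. (\<Sum>w\<in>{w\<in>V. E v w}. x w) - r * x v) \<ge> 0"
proof -
  show "(\<Sum>w\<in>W. real (deg N w) * (1 - x w)) \<ge> 0"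
    using x01 V_split(6) by (intro sum_nonneg mult_nonneg_nonneg) auto
  show "(r - (real k - 1)) * (sum x N - r) \<ge> 0"
    using r_bounds(2) sumN_ge by (intro mult_nonneg_nonneg) auto
  show "(\<Sum>v\<in>N. (\<Sum>w\<in>{w\<in>V. E v w}. x w) - r * x v) \<ge> 0"
    using sub V_split(5) by (intro sum_nonneg) auto
qed

lemma no_path_N:
  assumes "is_path N xs"
  shows "length xs < 2 * k"
proof (rule ccontr)
  assume "\<not> ?thesis"
  hence len: "length xs \<ge> 2 * k" by simp
  define ys where "ys = take (2 * k) xs"
  have ly: "length ys = 2 * k" using len by (simp add: ys_def)
  have p: "is_path N ys"
    using assms append_take_drop_id[of "2 * k" xs] set_take_subset[of "2 * k" xs]
    unfolding is_path_def ys_def by (metis distinct_take order_trans successively_append_iff)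
  have ne: "ys \<noteq> []" using ly k2 by auto
  have sN: "set ys \<subseteq> N" "distinct ys" "successively E ys" using p by (auto simp: is_path_def)
  have "hd ys \<in> N" "last ys \<in> N" using sN ne by auto
  hence "E u (hd ys)" "E (last ys) u" by (auto simp: N_def E_sym)
  moreover have "u \<notin> set ys" "set ys \<subseteq> V" using sN V_split by auto
  ultimately have "is_cyc V (u # ys)"
    using sN ne ly k2 u by (auto simp: is_cyc_def is_path_def successively_Cons)
  hence "card {w\<in>set (u # ys). E u w} < 2 * k - 1" using no_chorded[of "u # ys"] ly by simp
  moreover have "{w\<in>set (u # ys). E u w} = set ys" using sN E_irrefl by (auto simp: N_def)
  ultimately show False using sN(2) ly by (simp add: distinct_card)
qed

lemma x01_sub: "C \<subseteq> N \<Longrightarrow> \<forall>v\<in>C. 0 \<le> x v \<and> x v \<le> 1"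
  using x01 V_split(5) by auto

lemma eta_large_component:
  assumes "C \<subseteq> N" "connected_in C" "\<forall>v\<in>C. k \<le> deg C v + 1" "card C \<ge> 2 * k"
  shows "eta k x C \<le> - s"
    "eta k x C = - s \<Longrightarrow> (\<exists>A\<subseteq>C. card A = k - 1 \<and> (\<forall>v\<in>C - A. {w\<in>C. E v w} = A) \<and>
      (\<forall>v\<in>A. (\<forall>w\<in>A - {v}. E v w) \<and> x v = 1))"
proof -
  have fC: "finite C" using assms(1) by (rule finite_subN)
  have np: "\<forall>xs. is_path C xs \<longrightarrow> length xs < 2 * k"
    using no_path_N assms(1) unfolding is_path_def by blast
  note l = large_component_ecount[OF fC assms(2,4) k2 np assms(3), folded s_def]
  have e: "eta k x C \<le> ecount C - (real k - 1) * card C"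
    by (rule eta_le_ecount[OF fC assms(3) x01_sub[OF assms(1)]])
  show "eta k x C \<le> - s" using l(1) e by simp
  assume eq: "eta k x C = - s"
  hence "ecount C = (real k - 1) * card C - s" using l(1) e by simp
  then obtain A where A: "A \<subseteq> C" "card A = k - 1" "\<forall>v\<in>C - A. {w\<in>C. E v w} = A" "\<forall>v\<in>A. \<forall>w\<in>A - {v}. E v w"
    using l(2) by blast
  have fA: "finite A" using A(1) fC finite_subset by blast
  have pos: "0 \<le> (real (deg C v) - real k + 1) * (1 - x v)" if "v \<in> C" for v
  proof (rule mult_nonneg_nonneg)
    have "real k \<le> real (deg C v + 1)" using assms(3) that by (simp only: of_nat_le_iff)
    thus "0 \<le> real (deg C v) - real k + 1" by simp
  qed (use that x01_sub[OF assms(1)] in auto)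
  have "(\<Sum>v\<in>C. (real (deg C v) - real k + 1) * (1 - x v)) = 0"
    using eta_deficit[OF fC, of k x] eq \<open>ecount C = _\<close> by simp
  hence z: "\<forall>v\<in>C. (real (deg C v) - real k + 1) * (1 - x v) = 0"
    using sum_nonneg_eq_0_iff[OF fC, of "\<lambda>v. (real (deg C v) - real k + 1) * (1 - x v)"] pos by simp
  have "x v = 1" if v: "v \<in> A" for v
  proof -
    \<comment> \<open>There are at least k + 1 vertices in \<open>C - A\<close>, all adjacent to
      \<open>v\<close>, so \<open>v\<close> has a positive coefficient in the vanishing
      deficit.\<close>
    have "C - A \<subseteq> {w\<in>C. E v w}" using A(3) v E_sym by blast
    hence "card (C - A) \<le> deg C v" unfolding deg_def using fC by (intro card_mono) auto
    hence "k \<le> deg C v" using A(1,2) fA assms(4) by (simp add: card_Diff_subset)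
    hence "real (deg C v) - real k + 1 \<noteq> 0" by linarith
    thus ?thesis using z v A(1) by auto
  qed
  thus "\<exists>A\<subseteq>C. card A = k - 1 \<and> (\<forall>v\<in>C - A. {w\<in>C. E v w} = A) \<and>
      (\<forall>v\<in>A. (\<forall>w\<in>A - {v}. E v w) \<and> x v = 1)"
    using A by blast
qed

section \<open>Components on at most 2k - 1 vertices\<close>

lemma sum_x_card: "C \<subseteq> N \<Longrightarrow> sum x C \<le> card C"
  using sum_mono[of C x "\<lambda>_. 1"] x01_sub[of C] by simp

text \<open>Comparison with a complete graph on \<open>h\<close> vertices gives the deficit h(2k - 1
  - h)/2. It vanishes at h = 2k - 1, which is why that size needs a separate argument.\<close>

lemma eta_small_component:
  assumes "C \<subseteq> N" "\<forall>v\<in>C. k \<le> deg C v + 1" "card C < 2 * k"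
  shows "eta k x C \<le> 0" "card C < 2 * k - 1 \<Longrightarrow> eta k x C \<le> - c * sum x C"
proof -
  have fC: "finite C" using assms(1) by (rule finite_subN)
  define h where "h = real (card C)"
  have e: "eta k x C \<le> ecount C - (real k - 1) * h" unfolding h_def
    by (rule eta_le_ecount[OF fC assms(2) x01_sub[OF assms(1)]])
  have "ecount C \<le> h * (h - 1) / 2" unfolding h_def by (rule ecount_le[OF fC])
  hence e2: "eta k x C \<le> - (h * (2 * real k - 1 - h) / 2)" using e by (simp add: field_simps)
  have h0: "h \<ge> 0" by (simp add: h_def)
  have "h \<le> 2 * real k - 1" using assms(3) unfolding h_def by linarith
  hence "h * (2 * real k - 1 - h) \<ge> 0" using h0 by (intro mult_nonneg_nonneg) auto
  thus "eta k x C \<le> 0" using e2 by simp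
  assume "card C < 2 * k - 1"
  hence "1 \<le> 2 * real k - 1 - h" unfolding h_def by linarith
  hence "h * 1 \<le> h * (2 * real k - 1 - h)" using h0 by (rule mult_left_mono)
  hence "eta k x C \<le> - h / 2" using e2 by simp
  moreover have "c * sum x C \<le> 1 / 2 * h"
    using c_bounds(1,2) sum_x_card[OF assms(1)] h0 sum_x_nonneg[of C] assms(1) V_split(5)
    by (intro mult_mono) (auto simp: h_def)
  ultimately show "eta k x C \<le> - c * sum x C" by simp
qed

text \<open>A vertex with two neighbours in a nearly complete \<^term>\<open>C\<close> on \<open>2k - 1\<close> vertices closes a
  Hamiltonian path of \<open>C \<union> {u}\<close> to a cycle in which \<open>u\<close> has all of \<open>C\<close> as neighbours.\<close>

lemma deg_dense_component:
  assumes C: "C \<subseteq> N" "card C = 2 * k - 1"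
    and mu: "(2 * real k - 1) * (real k - 1) - ecount C < c * (2 * real k - 1)"
    and z: "z \<in> V - C - {u}"
  shows "deg C z \<le> 1"
proof (rule ccontr)
  assume "\<not> ?thesis"
  then obtain T where "T \<subseteq> {w\<in>C. E z w}" "card T = 2"
    unfolding deg_def by (metis obtain_subset_with_card_n not_less_eq_eq numeral_2_eq_2 One_nat_def)
  then obtain a b where ab: "a \<in> C" "b \<in> C" "E z a" "E z b" "a \<noteq> b" by (auto simp: card_2_iff)
  have fC: "finite C" using C(1) by (rule finite_subN)
  have uC: "u \<notin> C" using C V_split by auto
  let ?S = "insert u C"
  have cS: "card ?S = 2 * k" using fC uC C(2) k2 by simp
  have "?S - {u} = C" using uC by auto
  moreover have "deg ?S u = card C"
    unfolding deg_def using C(1) E_irrefl by (intro arg_cong[of _ _ card]) (auto simp: N_def)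
  ultimately have eS: "ecount ?S = ecount C + (2 * real k - 1)"
    using ecount_remove[of ?S u] fC C(2) k2 by (simp add: of_nat_diff)
  \<comment> \<open>The left-hand side counts the edges missing in \<open>C\<close>; on 2k vertices
    \<open>hamilton_connected\<close> allows k - 3/2 of them.\<close>
  have "(2 * real k - 1) * (real k - 1) - ecount C < real k - 3 / 2"
    using mu c_bounds(3) by (rule less_le_trans)
  hence "card ?S * (real (card ?S) - 1) - 2 * ecount ?S + 3 \<le> card ?S"
    unfolding cS eS by (simp add: algebra_simps)
  moreover have "finite ?S" "a \<in> ?S" "b \<in> ?S" "3 \<le> card ?S" using fC ab cS k2 by auto
  ultimately obtain xs where xs: "is_path ?S xs" "set xs = ?S" "hd xs = a" "last xs = b"
    using hamilton_connected[of ?S a b] ab(5) by blast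
  have l: "length xs = 2 * k" using xs(1,2) cS by (metis is_path_def distinct_card)
  have xs': "distinct xs" "successively E xs" "E z (hd xs)" "E (last xs) z" "z \<notin> set xs" "set xs \<subseteq> V" "xs \<noteq> []"
    using xs ab z C V_split u l k2 E_sym[of z b] by (auto simp: is_path_def)
  have "is_cyc V (z # xs)"
    using xs' z l k2 by (auto simp: is_cyc_def is_path_def successively_Cons)
  moreover have "u \<in> set (z # xs)" using xs(2) by simp
  moreover have "length (z # xs) = 2 * k + 1" using l by simp
  ultimately have "card {w\<in>set (z # xs). E u w} < 2 * k - 1" by (intro no_chorded)
  moreover have "card C \<le> card {w\<in>set (z # xs). E u w}"
    by (rule card_mono) (use xs(2) C(1) finite_set[of "z # xs"] in \<open>auto simp: N_def simp del: finite_set\<close>)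
  ultimately show False using C(2) by simp
qed

text \<open>The degree sum over \<open>W\<close> counts only the edges inside \<open>W\<close>
  twice, so it exceeds the size of the graph by at most \<open>s\<close>. The bound limits the
  weight that \<open>W\<close> can pass to a component of the core.\<close>

lemma sum_x_W_le:
  assumes "ecount W \<le> s"
  shows "sum x W \<le> r - real k + 2"
proof -
  have dW: "deg V w = deg N w + deg W w" if "w \<in> W" for w
  proof -
    have "\<not> E w u" using that E_sym V_split(6) unfolding W_def N_def by blast
    hence "{v\<in>V. E w v} = {v\<in>N \<union> W. E w v}" using V_split(1) by auto
    hence "deg V w = deg (N \<union> W) w" by (simp add: deg_def)
    thus ?thesis using deg_Un[OF finN finW V_split(4)] by simp
  qed
  have "r * sum x W \<le> (\<Sum>w\<in>W. \<Sum>v\<in>{v\<in>V. E w v}. x v)"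
    unfolding sum_distrib_left using sub V_split(6) by (intro sum_mono) auto
  also have "\<dots> \<le> (\<Sum>w\<in>W. real (deg V w))"
  proof (rule sum_mono)
    fix w assume "w \<in> W"
    have "(\<Sum>v\<in>{v\<in>V. E w v}. x v) \<le> (\<Sum>v\<in>{v\<in>V. E w v}. 1)"
      using x01 by (intro sum_mono) auto
    thus "(\<Sum>v\<in>{v\<in>V. E w v}. x v) \<le> real (deg V w)" by (simp add: deg_def)
  qed
  also have "\<dots> = (\<Sum>w\<in>W. real (deg N w)) + 2 * ecount W"
    by (simp add: dW sum.distrib ecount_def)
  also have "\<dots> \<le> ecount V + s"
    using size_split assms ecount_nonneg[of N] by simp
  also have "\<dots> \<le> r\<^sup>2 - (real k - 1) * r + 2 * s" using size_le by (simp add: s_def)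
  also have "\<dots> \<le> r * (r - real k + 2)" using r_bounds(3) by (simp add: s_def algebra_simps power2_eq_square)
  finally show ?thesis using r_bounds(1) by simp
qed

text \<open>If \<open>mu\<close>, the number of edges missing in \<open>C\<close>, is large, it is
  deficit enough. Otherwise outside vertices except \<open>u\<close> have at most one neighbour in
  \<open>C\<close>, so the weight reaching \<open>C\<close> from them is at most
  \<open>sum x T\<close>, roughly \<open>r\<close>; this keeps \<open>sum x C\<close> below
  2.\<close>

lemma eta_critical_component:
  assumes U: "U \<subseteq> N" "component_of U C" and C: "\<forall>v\<in>C. k \<le> deg C v + 1" "card C = 2 * k - 1"
    and R: "sum x (N - U) \<le> s" and eW: "ecount W \<le> s"
  shows "eta k x C \<le> - c * sum x C"
proof -
  have CN: "C \<subseteq> N" and CU: "C \<subseteq> U" using U by (auto simp: component_of_def)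
  have CV: "C \<subseteq> V" using CN V_split by auto
  have fC: "finite C" using CN by (rule finite_subN)
  have h: "real (card C) = 2 * real k - 1" using C(2) k2 by (simp add: of_nat_diff)
  define mu where "mu = (2 * real k - 1) * (real k - 1) - ecount C"
  show ?thesis
  proof (cases "mu \<ge> c * (2 * real k - 1)")
    case True
    have "eta k x C \<le> - mu"
      using eta_le_ecount[OF fC C(1) x01_sub[OF CN]] h by (simp add: mu_def algebra_simps)
    moreover have "c * sum x C \<le> c * (2 * real k - 1)"
      using sum_x_card[OF CN] c_bounds(1) h by simp
    ultimately show ?thesis using True by simp
  next
    case False
    have d1: "deg C z \<le> 1" if "z \<in> V - C - {u}" for z
      by (rule deg_dense_component[OF CN C(2) _ that]) (use False in \<open>simp add: mu_def\<close>)
    define T where "T = {z\<in>V - C - {u}. deg C z \<noteq> 0}"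
    have TU: "T \<subseteq> (N - U) \<union> W"
    proof
      fix z assume z: "z \<in> T"
      hence "{w\<in>C. E z w} \<noteq> {}" unfolding T_def deg_def by (metis (mono_tags, lifting) card.empty mem_Collect_eq)
      then obtain w where w: "w \<in> C" "E z w" by blast
      have "z \<notin> U"
      proof
        assume "z \<in> U"
        hence "z \<in> U - C" using z by (simp add: T_def)
        thus False using U(2) w E_sym unfolding component_of_def separated_def by blast
      qed
      thus "z \<in> (N - U) \<union> W" using z V_split(1) by (auto simp: T_def)
    qed
    have "sum x T \<le> sum x ((N - U) \<union> W)" using TU V_split by (intro sum_x_mono) auto
    also have "\<dots> = sum x (N - U) + sum x W" using V_split(4) by (intro sum.union_disjoint) auto
    also have "\<dots> \<le> s + (r - real k + 2)" using R sum_x_W_le[OF eW] by simp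
    finally have xT: "sum x T \<le> s + (r - real k + 2)" .
    have "r * sum x C \<le> (\<Sum>v\<in>C. \<Sum>w\<in>{w\<in>V. E v w}. x w)"
      unfolding sum_distrib_left using sub CV by (intro sum_mono) auto
    also have "\<dots> = (\<Sum>w\<in>V. real (deg C w) * x w)" by (rule sum_nbr[OF CV])
    also have "\<dots> = real (deg C u) * x u + (\<Sum>w\<in>C. real (deg C w) * x w) + (\<Sum>w\<in>V - C - {u}. real (deg C w) * x w)"
    proof -
      have eq: "insert u (C \<union> (V - C - {u})) = V" using u CV by auto
      have "u \<notin> C" using CN V_split by auto
      hence "(\<Sum>w\<in>insert u (C \<union> (V - C - {u})). real (deg C w) * x w) = real (deg C u) * x u +
          ((\<Sum>w\<in>C. real (deg C w) * x w) + (\<Sum>w\<in>V - C - {u}. real (deg C w) * x w))"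
        using fC fin sum.union_disjoint[of C "V - C - {u}" "\<lambda>w. real (deg C w) * x w"] by auto
      thus ?thesis unfolding eq by simp
    qed
    also have "real (deg C u) * x u \<le> 2 * real k - 1"
      using card_mono[OF fC, of "{w\<in>C. E u w}"] h u by (simp add: deg_def)
    also have "(\<Sum>w\<in>C. real (deg C w) * x w) \<le> (2 * real k - 2) * sum x C"
      unfolding sum_distrib_left
    proof (intro sum_mono mult_right_mono)
      fix w assume w: "w \<in> C"
      show "real (deg C w) \<le> 2 * real k - 2" using deg_less_card[OF fC w] h by linarith
    qed (use x01_sub[OF CN] in auto)
    also have "(\<Sum>w\<in>V - C - {u}. real (deg C w) * x w) \<le> sum x T"
    proof -
      have "(\<Sum>w\<in>V - C - {u}. real (deg C w) * x w) \<le> (\<Sum>w\<in>V - C - {u}. if deg C w \<noteq> 0 then x w else 0)"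
      proof (rule sum_mono)
        fix w assume w: "w \<in> V - C - {u}"
        thus "real (deg C w) * x w \<le> (if deg C w \<noteq> 0 then x w else 0)"
          using d1[OF w] by (cases "deg C w = 0") (auto simp: le_Suc_eq)
      qed
      also have "\<dots> = sum x T" unfolding T_def using fin by (intro sum.inter_filter[symmetric]) auto
      finally show ?thesis .
    qed
    finally have "(r - 2 * real k + 2) * sum x C \<le> 2 * real k - 1 + sum x T" by (simp add: algebra_simps)
    also have "\<dots> \<le> 2 * (r - 2 * real k + 2)" using xT r_bounds(5) by (simp add: algebra_simps)
    finally have "(r - 2 * real k + 2) * sum x C \<le> (r - 2 * real k + 2) * 2" by (simp add: mult.commute)
    moreover have "r - 2 * real k + 2 > 0" using r_bounds(5) real_k_ge_2 s_pos by linarith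
    ultimately have x2: "sum x C \<le> 2" using mult_le_cancel_left_pos by blast
    have "(\<Sum>v\<in>C. (real (deg C v) - real k + 1) * x v) \<le> (\<Sum>v\<in>C. (real k - 1) * x v)"
    proof (intro sum_mono mult_right_mono)
      fix w assume w: "w \<in> C"
      show "real (deg C w) - real k + 1 \<le> real k - 1" using deg_less_card[OF fC w] h by linarith
    qed (use x01_sub[OF CN] in auto)
    hence "eta k x C \<le> (real k - 1) * sum x C - (2 * real k - 1) * (real k - 1) + mu"
      by (simp add: eta_def mu_def sum_distrib_left)
    moreover have "(real k - 1 + c) * sum x C \<le> (real k - 1 + c) * 2"
      using x2 real_k_ge_2 c_bounds(1) by (intro mult_left_mono) auto
    ultimately show ?thesis using c_bounds(4) False by (simp add: algebra_simps)
  qed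
qed

theorem extremal_structure:
  assumes iso: "\<forall>v\<in>V. \<exists>w. E v w"
  shows "\<exists>A\<subseteq>V. card A = k \<and> (\<forall>a\<in>A. \<forall>b\<in>V - {a}. E a b) \<and> (\<forall>v\<in>V - A. \<forall>w\<in>V - A. \<not> E v w)"
proof -
  obtain U where U: "U \<subseteq> N" "\<forall>v\<in>U. k \<le> deg U v + 1" "eta k x N \<le> eta k x U - sum x (N - U)"
    using ex_min_degree_core[OF finN, of x k] x01_sub[of N] by auto
  have fU: "finite U" using U(1) by (rule finite_subN)
  have comp: "C \<subseteq> U" "C \<subseteq> N" "connected_in C" "C \<noteq> {}" "\<forall>v\<in>C. k \<le> deg C v + 1"
    if C: "component_of U C" for C
  proof -
    show CU: "C \<subseteq> U" "C \<subseteq> N" "connected_in C" "C \<noteq> {}"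
      using C U(1) by (auto simp: component_of_def connected_in_def)
    have fC: "finite C" using CU(1) fU finite_subset by blast
    have fUC: "finite (U - C)" using fU by simp
    have sep: "separated C (U - C)" using C by (simp add: component_of_def)
    have CUU: "C \<union> (U - C) = U" using CU by auto
    have dU: "deg U v = deg C v" if "v \<in> C" for v
      using separated_deg(3)[OF sep fC fUC that] unfolding CUU .
    show "\<forall>v\<in>C. k \<le> deg C v + 1"
    proof
      fix v assume v: "v \<in> C"
      hence "k \<le> deg U v + 1" using U(2) CU(1) by blast
      thus "k \<le> deg C v + 1" using dU[OF v] by simp
    qed
  qed
  have add: "\<forall>A B. finite A \<and> finite B \<and> separated A B \<longrightarrow> eta k x (A \<union> B) = eta k x A + eta k x B"
    using eta_Un by blast
  have eta0: "eta k x {} = 0" by (simp add: eta_def ecount_def)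
  have comp_nonpos: "eta k x C \<le> 0" if C: "component_of U C" for C
    using eta_small_component(1)[OF comp(2,5)[OF C]] eta_large_component(1)[OF comp(2,3,5)[OF C]] s_pos
    by linarith
  have nonpos: "eta k x D \<le> 0" if "D \<subseteq> U" "\<forall>C. component_of D C \<longrightarrow> component_of U C" for D
    by (rule component_additive_nonpos[OF _ eta0 add]) (use that fU finite_subset comp_nonpos in blast)+
  have UU: "eta k x U \<le> 0" by (rule nonpos) auto
  note sl = slacks_nonneg
  have xNU: "sum x (N - U) \<ge> 0" using V_split(5) by (intro sum_x_nonneg) auto
  \<comment> \<open>\<open>small\<close> depends on these two rough bounds, so they are drawn from
    \<open>UU\<close> alone, before any component of size 2k - 1 is known to have a deficit.\<close>
  have R: "sum x (N - U) \<le> s" using eta_nbhd_ge U(3) UU sl ecount_nonneg[of W] by linarith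
  have eW: "ecount W \<le> s" using eta_nbhd_ge U(3) UU sl xNU by linarith
  have small: "eta k x C \<le> - c * sum x C" if C: "component_of U C" "card C < 2 * k" for C
  proof (cases "card C < 2 * k - 1")
    case True
    thus ?thesis using eta_small_component(2)[OF comp(2,5)[OF C(1)] C(2)] by simp
  next
    case False
    hence "card C = 2 * k - 1" using C(2) by simp
    thus ?thesis using eta_critical_component[OF U(1) C(1) comp(5)[OF C(1)] _ R eW] by simp
  qed
  have "\<exists>C. component_of U C \<and> card C \<ge> 2 * k"
  proof (rule ccontr)
    assume "\<not> ?thesis"
    hence all: "card C < 2 * k" if "component_of U C" for C using that not_less by blast
    have "eta k x U + c * sum x U \<le> 0"
    proof (rule component_additive_nonpos[of U "\<lambda>C. eta k x C + c * sum x C", OF fU])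
      show "\<forall>A B. finite A \<and> finite B \<and> separated A B \<longrightarrow>
          eta k x (A \<union> B) + c * sum x (A \<union> B) = eta k x A + c * sum x A + (eta k x B + c * sum x B)"
        using add by (auto simp: separated_def sum.union_disjoint algebra_simps)
      show "\<forall>C. component_of U C \<longrightarrow> eta k x C + c * sum x C \<le> 0"
        using small all by fastforce
    qed (simp add: eta0)
    moreover have "sum x N = sum x U + sum x (N - U)"
      using sum.subset_diff[OF U(1) finN, of x] by simp
    hence "c * sum x N = c * sum x U + c * sum x (N - U)" by (simp add: algebra_simps)
    \<comment> \<open>Deleted vertices pay with their full weight, hence at least at rate
      \<open>c\<close>; so all of \<open>N\<close> pays at that rate.\<close>
    moreover have "c * sum x (N - U) \<le> 1 * sum x (N - U)"
      using c_bounds(2) xNU by (intro mult_right_mono) auto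
    moreover have "c * r \<le> c * sum x N" using sumN_ge c_bounds(1) by simp
    ultimately have "eta k x N \<le> - (c * r)" using U(3) by linarith
    thus False using eta_nbhd_ge sl ecount_nonneg[of W] r_bounds(4) by linarith
  qed
  then obtain C where C: "component_of U C" "card C \<ge> 2 * k" by blast
  note Cc = comp[OF C(1)]
  have fC: "finite C" using Cc(1) fU finite_subset by blast
  have "separated C (U - C)" using C(1) by (simp add: component_of_def)
  hence "eta k x (C \<union> (U - C)) = eta k x C + eta k x (U - C)" using eta_Un fC fU by blast
  moreover have "C \<union> (U - C) = U" using Cc by auto
  ultimately have split: "eta k x U = eta k x C + eta k x (U - C)" by simp
  have rest: "eta k x (U - C) \<le> 0" using component_of_Diff[OF C(1)] by (intro nonpos) auto
  have large: "eta k x C \<le> - s" by (rule eta_large_component(1)[OF Cc(2,3,5) C(2)])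
  \<comment> \<open>The value -\<open>s\<close> of the one large component uses up the whole
    allowance of \<open>eta_nbhd_ge\<close>, so every other term must be 0.\<close>
  have eqs: "eta k x C = - s" "eta k x (U - C) = 0" "sum x (N - U) = 0" "ecount W = 0"
    "(\<Sum>w\<in>W. real (deg N w) * (1 - x w)) = 0" "(r - (real k - 1)) * (sum x N - r) = 0"
    "(\<Sum>v\<in>N. (\<Sum>w\<in>{w\<in>V. E v w}. x w) - r * x v) = 0"
    using eta_nbhd_ge U(3) split rest large sl xNU ecount_nonneg[of W] by linarith+
  have "real k * (real k - 1) \<ge> 2 * (real k - 1)" using real_k_ge_2 by (intro mult_right_mono) auto
  hence "2 * (real k - 1) \<le> r" using r_bounds(3) by (rule order.trans)
  hence "2 * real k - 2 \<le> r" by (simp add: algebra_simps)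
  hence "r > real k - 1" using real_k_ge_2 by linarith
  hence X: "sum x N = r" using eqs(6) by simp
  have eig: "(\<Sum>w\<in>{w\<in>V. E v w}. x w) = r * x v" if "v \<in> N" for v
    using sum_nonneg_eq_0_iff[OF finN, of "\<lambda>v. (\<Sum>w\<in>{w\<in>V. E v w}. x w) - r * x v"] eqs(7) sub that V_split(5)
    by auto
  \<comment> \<open>The equation \<open>eig\<close> transfers positivity from \<open>u\<close> to
    its neighbours.\<close>
  have xpos: "x v > 0" if v: "v \<in> N" for v
  proof -
    have "E v u" "v \<in> V" using v E_sym by (auto simp: N_def)
    hence "x u \<le> (\<Sum>w\<in>{w\<in>V. E v w}. x w)"
      using u x01 fin by (intro member_le_sum) auto
    hence "r * x v \<ge> 1" using eig[OF v] u by simp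
    hence "r * x v > 0" by simp
    thus ?thesis using r_bounds(1) zero_less_mult_pos by blast
  qed
  have sum_pos: "sum x D > 0" if "D \<subseteq> N" "D \<noteq> {}" for D
    using that finite_subN xpos by (intro sum_pos) auto
  have "N - U = {}" using sum_pos[of "N - U"] eqs(3) by auto
  hence NU: "U = N" using U(1) by auto
  have "U - C = {}"
  proof (rule ccontr)
    assume "U - C \<noteq> {}"
    then obtain D where D: "component_of (U - C) D" using ex_component fU by blast
    have DU: "component_of U D" by (rule component_of_Diff[OF C(1) D])
    note Dc = comp[OF DU]
    \<comment> \<open>Any second component would have a strict deficit, now that weights on
      \<open>N\<close> are positive.\<close>
    have "eta k x D < 0"
    proof (cases "card D < 2 * k")
      case True
      have "c * sum x D > 0" using sum_pos[OF Dc(2,4)] c_bounds(1) by simp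
      thus ?thesis using small[OF DU True] by simp
    next
      case False
      thus ?thesis using eta_large_component(1)[OF Dc(2,3,5)] s_pos by linarith
    qed
    moreover have "eta k x (U - C - D) \<le> 0"
      using component_of_Diff[OF C(1)] component_of_Diff[OF D] by (intro nonpos) blast+
    moreover have "separated D (U - C - D)" "D \<subseteq> U - C" using D by (auto simp: component_of_def)
    moreover have "eta k x (D \<union> (U - C - D)) = eta k x D + eta k x (U - C - D)"
      using \<open>separated D _\<close> fU Dc(1) finite_subset by (intro eta_Un) auto
    moreover have "D \<union> (U - C - D) = U - C" using \<open>D \<subseteq> U - C\<close> by auto
    ultimately show False using eqs(2) by simp
  qed
  hence CN: "C = N" using Cc NU by auto
  obtain A where A: "A \<subseteq> N" "card A = k - 1" "\<forall>v\<in>N - A. {w\<in>N. E v w} = A"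
    "\<forall>v\<in>A. (\<forall>w\<in>A - {v}. E v w) \<and> x v = 1"
    using eta_large_component(2)[OF Cc(2,3,5) C(2) eqs(1)] unfolding CN by blast
  have fA: "finite A" using A(1) by (rule finite_subN)
  have adjA: "E a b" if "a \<in> A" "b \<in> N - {a}" for a b
    using that A E_sym by blast
  have "W = {}"
  proof (rule ccontr)
    assume "W \<noteq> {}"
    then obtain w where w: "w \<in> W" by blast
    have wV: "w \<in> V" "w \<noteq> u" "w \<notin> N" using w by (auto simp: W_def)
    obtain y where y: "E w y" using iso wV by blast
    have yV: "y \<in> V" using E_V E_sym y by blast
    have nu: "\<not> E w u" using wV E_sym by (auto simp: N_def)
    have "(\<Sum>v\<in>W. real (deg W v)) = 0" using eqs(4) by (simp add: ecount_def)
    hence "deg W w = 0" using w by (simp add: sum_nonneg_eq_0_iff)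
    hence "{v\<in>W. E w v} = {}" using finW by (simp add: deg_def)
    hence nW: "\<not> E w v" if "v \<in> W" for v using that by blast
    have nbrN: "{v\<in>V. E w v} = {v\<in>N. E w v}" 
    proof (intro Collect_cong)
      fix v
      have "v \<in> V \<longleftrightarrow> v = u \<or> v \<in> N \<or> v \<in> W" using V_split(1) by blast
      thus "(v \<in> V \<and> E w v) = (v \<in> N \<and> E w v)" using nW nu by blast
    qed
    hence "y \<in> {v\<in>N. E w v}" using y yV by blast
    hence "deg N w \<noteq> 0" unfolding deg_def using finN by (auto simp: card_eq_0_iff)
    moreover have "0 \<le> real (deg N v) * (1 - x v)" if "v \<in> W" for v
      using x01[of v] V_split(6) that by auto
    hence "real (deg N w) * (1 - x w) = 0"
      using eqs(5) w sum_nonneg_eq_0_iff[OF finW, of "\<lambda>w. real (deg N w) * (1 - x w)"] by blast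
    ultimately have xw: "x w = 1" by simp
    \<comment> \<open>All neighbours of \<open>w\<close> lie in \<open>N\<close>, whose total weight
      is only \<open>r\<close>; as weights there are positive, \<open>w\<close> must see all of
      \<open>N\<close>.\<close>
    have "r \<le> sum x {v\<in>N. E w v}" using sub[OF wV(1)] xw nbrN by simp
    moreover have "sum x N = sum x {v\<in>N. E w v} + sum x (N - {v\<in>N. E w v})"
      using sum.subset_diff[of "{v\<in>N. E w v}" N x] by simp
    ultimately have "N - {v\<in>N. E w v} = {}" using X sum_pos[of "N - {v\<in>N. E w v}"] by fastforce
    hence wN: "E w v" if "v \<in> N" for v using that by blast
    have "A \<noteq> {}" using A(2) k2 by auto
    then obtain a where a: "a \<in> A" by blast
    have aN: "a \<in> N" using a A by blast
    \<comment> \<open>\<open>w\<close> acts as a second copy of \<open>u\<close>: the neighbours of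
      \<open>a\<close> would have total weight at least r + 1, while \<open>eig\<close> allows only
      \<open>r\<close>.\<close>
    have sub': "insert u (insert w (N - {a})) \<subseteq> {v\<in>V. E a v}"
      using adjA[OF a] aN wN[OF aN] wV u V_split(5) E_sym by (auto simp: N_def)
    have "sum x (insert u (insert w (N - {a}))) \<le> sum x {v\<in>V. E a v}"
      using sub' by (intro sum_x_mono) auto
    also have "\<dots> = r * 1" using eig[OF aN] A(4) a by simp
    finally have "x u + (x w + sum x (N - {a})) \<le> r"
      using wV V_split(2) by simp
    moreover have "sum x N = x a + sum x (N - {a})" using aN by (simp add: sum.remove)
    ultimately show False using X xw u A(4) a by simp
  qed
  hence VN: "V = insert u N" using V_split(1) by simp
  have Eu: "E u b" if "b \<in> N" for b using that by (simp add: N_def)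
  have uA: "u \<notin> A" using A(1) V_split(2) by auto
  show ?thesis
  proof (intro exI[of _ "insert u A"] conjI ballI)
    show "insert u A \<subseteq> V" using VN A(1) by auto
    show "card (insert u A) = k" using fA uA A(2) k2 by simp
    fix a b assume ab: "a \<in> insert u A" "b \<in> V - {a}"
    hence "b \<in> insert u N" using VN by blast
    thus "E a b" using ab adjA[of a b] Eu[of b] Eu[of a] A(1) E_sym[of u a] by blast
  next
    fix v w assume vw: "v \<in> V - insert u A" "w \<in> V - insert u A"
    hence "{y\<in>N. E v y} = A" using A(3) VN by blast
    thus "\<not> E v w" using vw VN by blast
  qed
qed

end

section \<open>Transfer to graphs given by edge sets\<close>

lemma adjacency_simple_graph:
  assumes "simple_graph G"
  shows "adjacency (\<lambda>v w. {v, w} \<in> edges G)"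
  using simple_graph_edgeD(1)[OF assms, of v v for v] by unfold_locales (auto simp: insert_commute)

lemma ecount_card_edges:
  assumes "simple_graph G"
  shows "adjacency.ecount (\<lambda>v w. {v, w} \<in> edges G) (verts G) = card (edges G)"
proof -
  interpret adjacency "\<lambda>v w. {v, w} \<in> edges G" by (rule adjacency_simple_graph[OF assms])
  have finV: "finite (verts G)" using assms by (simp add: simple_graph_def)
  have "edges G \<subseteq> Pow (verts G)" using assms by (auto simp: simple_graph_def)
  hence finE: "finite (edges G)" using finV finite_subset by blast
  have "real (deg (verts G) v) = (\<Sum>e\<in>edges G. if v \<in> e then 1 else 0)" if v: "v \<in> verts G" for v
  proof -
    have "bij_betw (\<lambda>w. {v, w}) {w \<in> verts G. {v, w} \<in> edges G} {e \<in> edges G. v \<in> e}"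
      unfolding bij_betw_def
    proof
      show "inj_on (\<lambda>w. {v, w}) {w \<in> verts G. {v, w} \<in> edges G}"
        by (auto simp: inj_on_def doubleton_eq_iff)
      show "(\<lambda>w. {v, w}) ` {w \<in> verts G. {v, w} \<in> edges G} = {e \<in> edges G. v \<in> e}"
      proof (intro equalityI subsetI)
        fix e assume e: "e \<in> {e \<in> edges G. v \<in> e}"
        hence "card e = 2" "e \<subseteq> verts G" using assms by (auto simp: simple_graph_def)
        then obtain w where "e = {v, w}" "w \<in> verts G" using e by (auto simp: card_2_iff)
        thus "e \<in> (\<lambda>w. {v, w}) ` {w \<in> verts G. {v, w} \<in> edges G}" using e by auto
      qed auto
    qed
    hence "deg (verts G) v = card {e \<in> edges G. v \<in> e}" unfolding deg_def by (rule bij_betw_same_card)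
    thus ?thesis using finE by (simp add: sum.inter_filter[symmetric])
  qed
  hence "(\<Sum>v\<in>verts G. real (deg (verts G) v)) = (\<Sum>v\<in>verts G. \<Sum>e\<in>edges G. if v \<in> e then 1 else 0)"
    by simp
  also have "\<dots> = (\<Sum>e\<in>edges G. \<Sum>v\<in>verts G. if v \<in> e then 1 else 0)" by (rule sum.swap)
  also have "\<dots> = (\<Sum>e\<in>edges G. 2)"
  proof (rule sum.cong)
    fix e assume "e \<in> edges G"
    hence e: "card e = 2" "e \<subseteq> verts G" using assms by (auto simp: simple_graph_def)
    have "{v \<in> verts G. v \<in> e} = e" using e by auto
    thus "(\<Sum>v\<in>verts G. if v \<in> e then 1 else 0) = (2::real)"
      using e finV by (simp add: sum.inter_filter[symmetric])
  qed simp
  finally show ?thesis by (simp add: ecount_def)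
qed

text \<open>Rotating \<open>u\<close> to index 0 puts its neighbours along the cycle at indices 1
  and \<open>?n - 1\<close>; every other neighbour of \<open>u\<close> on the cycle gives a
  chord.\<close>

lemma chorded_cycle_of_nbrs:
  assumes G: "simple_graph G"
    and c: "adjacency.is_cyc (\<lambda>v w. {v, w} \<in> edges G) (verts G) c"
    and u: "u \<in> set c" and nb: "card {w \<in> set c. {u, w} \<in> edges G} \<ge> s + 2"
  shows "contains_chorded_cycle G s (length c)"
proof -
  interpret adjacency "\<lambda>v w. {v, w} \<in> edges G" by (rule adjacency_simple_graph[OF G])
  obtain i where i: "i < length c" "c ! i = u" using u by (metis in_set_conv_nth)
  define d where "d = rotate i c"
  have d: "is_cyc (verts G) d" unfolding d_def by (rule is_cyc_rotate[OF c])
  have ld: "length d = length c" "set d = set c" by (simp_all add: d_def)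
  have d0: "d ! 0 = u" using nth_rotate[of 0 c i] i by (cases "c = []") (auto simp: d_def)
  have dd: "distinct d" "length d \<ge> 3" "set d \<subseteq> verts G" "successively (\<lambda>v w. {v, w} \<in> edges G) d"
    "{last d, hd d} \<in> edges G"
    using d by (auto simp: is_cyc_def is_path_def)
  let ?n = "length d"
  have ne: "d \<noteq> []" using dd by auto
  have ce: "cycle_edges d \<subseteq> edges G"
  proof
    fix e assume "e \<in> cycle_edges d"
    then obtain j where j: "j < ?n" "e = {d ! j, d ! (Suc j mod ?n)}" by (auto simp: cycle_edges_def)
    show "e \<in> edges G"
    proof (cases "Suc j < ?n")
      case True
      thus ?thesis using j successively_nth[OF dd(4), of j] by simp
    next
      case False
      hence "Suc j = ?n" using j by simp
      moreover from this have "j = ?n - 1" by simp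
      ultimately show ?thesis using j dd(5) ne by (simp add: last_conv_nth hd_conv_nth)
    qed
  qed
  define F where "F = {w \<in> set c. {u, w} \<in> edges G} - {d ! 1, d ! (?n - 1)}"
  have "(\<lambda>w. {u, w}) ` F \<subseteq> chords G d"
  proof
    fix e assume "e \<in> (\<lambda>w. {u, w}) ` F"
    then obtain w where w: "e = {u, w}" "w \<in> set c" "{u, w} \<in> edges G" "w \<noteq> d ! 1" "w \<noteq> d ! (?n - 1)"
      by (auto simp: F_def)
    have "e \<notin> cycle_edges d"
    proof
      assume "e \<in> cycle_edges d"
      then obtain j where j: "j < ?n" "{u, w} = {d ! j, d ! (Suc j mod ?n)}" using w by (auto simp: cycle_edges_def)
      hence "u = d ! j \<and> w = d ! (Suc j mod ?n) \<or> u = d ! (Suc j mod ?n) \<and> w = d ! j"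
        by (auto simp: doubleton_eq_iff)
      thus False
      proof
        assume a: "u = d ! j \<and> w = d ! (Suc j mod ?n)"
        hence "j = 0" using d0 dd(1) j(1) ne by (metis length_greater_0_conv nth_eq_iff_index_eq)
        thus False using a w(4) dd(2) by simp
      next
        assume a: "u = d ! (Suc j mod ?n) \<and> w = d ! j"
        have "Suc j mod ?n < ?n" using ne by simp
        hence "Suc j mod ?n = 0" using a d0 dd(1) ne by (metis length_greater_0_conv nth_eq_iff_index_eq)
        hence "j = ?n - 1" using j(1) by (metis Suc_lessI diff_Suc_1 mod_less nat.distinct(1))
        thus False using a w(5) by simp
      qed
    qed
    thus "e \<in> chords G d" using w u ld by (auto simp: chords_def)
  qed
  moreover have "finite (chords G d)"
    by (rule finite_subset[of _ "Pow (set d)"]) (auto simp: chords_def)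
  ultimately have "card ((\<lambda>w. {u, w}) ` F) \<le> card (chords G d)" by (intro card_mono)
  moreover have "card ((\<lambda>w. {u, w}) ` F) = card F"
    by (rule card_image) (auto simp: inj_on_def doubleton_eq_iff)
  moreover have "card {w \<in> set c. {u, w} \<in> edges G} - card {d ! 1, d ! (?n - 1)} \<le> card F"
    unfolding F_def by (rule diff_card_le_card_Diff) simp
  moreover have "card {d ! 1, d ! (?n - 1)} \<le> 2" by (simp add: card_insert_if)
  ultimately have "s \<le> card (chords G d)" using nb by linarith
  thus ?thesis unfolding contains_chorded_cycle_def is_cycle_def
    using ce dd ld by (intro exI[of _ d]) auto
qed

lemma graph_iso_complete_join_independent:
  assumes G: "simple_graph G" and A: "A \<subseteq> verts G" "card A = k"
    and full: "\<forall>a\<in>A. \<forall>b\<in>verts G - {a}. {a, b} \<in> edges G"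
    and indep: "\<forall>v\<in>verts G - A. \<forall>w\<in>verts G - A. {v, w} \<notin> edges G"
  shows "graph_iso G (graph_join (complete_graph k) (graph_copies (card (verts G - A)) (complete_graph 1)))"
proof -
  let ?t = "card (verts G - A)"
  let ?H = "graph_join (complete_graph k) (graph_copies ?t (complete_graph 1))"
  have finV: "finite (verts G)" using G by (simp add: simple_graph_def)
  have fA: "finite A" using A finV finite_subset by blast
  obtain g where g: "bij_betw g A {..<k}" using finite_same_card_bij[of A "{..<k}"] fA A by auto
  obtain h where h: "bij_betw h (verts G - A) {..<?t}"
    using finite_same_card_bij[of "verts G - A" "{..<?t}"] finV by auto
  define f where "f v = (if v \<in> A then Inl (g v) else Inr (h v, 0::nat))" for v
  have e1: "edges (complete_graph 1) = {}"
  proof -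
    have "card e \<noteq> 2" if "e \<subseteq> {..<1::nat}" for e
      using card_mono[OF _ that] by auto
    thus ?thesis by (auto simp: complete_graph_def)
  qed
  have eH: "edges ?H = image Inl ` {e. e \<subseteq> {..<k} \<and> card e = 2} \<union>
      {{Inl u, Inr v} | u v. u \<in> {..<k} \<and> v \<in> {..<?t} \<times> {0}}"
    using e1 by (auto simp: graph_join_def graph_copies_def complete_graph_def lessThan_Suc)
  have vH: "verts ?H = Inl ` {..<k} \<union> Inr ` ({..<?t} \<times> {0})"
    by (auto simp: graph_join_def graph_copies_def complete_graph_def Plus_def lessThan_Suc)
  have ga: "g a < k" if "a \<in> A" for a using g that by (auto simp: bij_betw_def)
  have hv: "h v < ?t" if "v \<in> verts G - A" for v using h that by (auto simp: bij_betw_def)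
  have inj: "inj_on f (verts G)"
    using g h by (auto simp: inj_on_def f_def bij_betw_def)
  have "f ` verts G = f ` A \<union> f ` (verts G - A)" using A by auto
  also have "f ` A = Inl ` g ` A" by (auto simp: f_def)
  also have "f ` (verts G - A) = Inr ` (h ` (verts G - A) \<times> {0})" by (auto simp: f_def)
  finally have im: "f ` verts G = verts ?H" using g h unfolding vH by (simp add: bij_betw_def)
  have "{v, w} \<in> edges G \<longleftrightarrow> {f v, f w} \<in> edges ?H" if vw: "v \<in> verts G" "w \<in> verts G" for v w
  proof -
    consider "v \<in> A" "w \<in> A" | "v \<in> A" "w \<notin> A" | "v \<notin> A" "w \<in> A" | "v \<notin> A" "w \<notin> A" by blast
    thus ?thesis
    proof cases
      case 1
      have "{v, w} \<in> edges G \<longleftrightarrow> v \<noteq> w" using 1 vw full simple_graph_edgeD(1)[OF G] by blast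
      also have "\<dots> \<longleftrightarrow> g v \<noteq> g w" using 1 g by (auto simp: bij_betw_def inj_on_def)
      also have "\<dots> \<longleftrightarrow> {Inl (g v), Inl (g w) :: nat + nat \<times> nat} \<in> image Inl ` {e. e \<subseteq> {..<k} \<and> card e = 2}"
      proof
        assume "g v \<noteq> g w"
        hence "{g v, g w} \<in> {e. e \<subseteq> {..<k} \<and> card e = 2}" using ga 1 by auto
        thus "{Inl (g v), Inl (g w) :: nat + nat \<times> nat} \<in> image Inl ` {e. e \<subseteq> {..<k} \<and> card e = 2}"
          by (intro image_eqI[of _ _ "{g v, g w}"]) auto
      next
        assume "{Inl (g v), Inl (g w) :: nat + nat \<times> nat} \<in> image Inl ` {e. e \<subseteq> {..<k} \<and> card e = 2}"
        then obtain e where e: "{Inl (g v), Inl (g w)} = (Inl ` e :: (nat + nat \<times> nat) set)" "card e = 2" by auto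
        hence "Inl ` {g v, g w} = (Inl ` e :: (nat + nat \<times> nat) set)" by simp
        hence "{g v, g w} = e" using inj_image_eq_iff[OF inj_Inl] by blast
        hence "card {g v, g w} = 2" using e(2) by simp
        thus "g v \<noteq> g w" by (auto simp: card_insert_if split: if_splits)
      qed
      also have "\<dots> \<longleftrightarrow> {f v, f w} \<in> edges ?H"
        unfolding eH f_def using 1 by (auto simp: doubleton_eq_iff)
      finally show ?thesis .
    next
      case 2
      have "{v, w} \<in> edges G" using 2 vw full by blast
      moreover have "{f v, f w} \<in> edges ?H"
        unfolding eH f_def using 2 ga[of v] hv[of w] vw by auto
      ultimately show ?thesis by simp
    next
      case 3
      have "{w, v} \<in> edges G" using 3 vw full by blast
      moreover have "{f w, f v} \<in> edges ?H"
        unfolding eH f_def using 3 ga[of w] hv[of v] vw by auto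
      ultimately show ?thesis by (simp add: insert_commute)
    next
      case 4
      have "{v, w} \<notin> edges G" using 4 vw indep by blast
      moreover have "{f v, f w} \<notin> edges ?H"
        unfolding eH f_def using 4 by (auto simp: doubleton_eq_iff)
      ultimately show ?thesis by simp
    qed
  qed
  thus ?thesis using inj im unfolding graph_iso_def bij_betw_def by blast
qed

theorem theorem1p2:
  fixes k m :: nat and G :: "'a ugraph"
  assumes "k \<ge> 2"
    and "real m \<ge> (7 * (real k)^2 + 6 * real k + 2)^2 / 16 + ((real k)^2 - 1) / 4"
    and "simple_graph G"
    and "isolate_free G"
    and "card (edges G) = m"
    and "graph_spectral_radius G \<ge> (real k - 1 + sqrt (4 * real m - (real k)^2 + 1)) / 2"
  shows "contains_chorded_cycle G (2 * k - 3) (2 * k + 1) \<or>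
    (\<exists>t::nat. real t = real m / real k - (real k - 1) / 2 \<and>
       graph_iso G (graph_join (complete_graph k) (graph_copies t (complete_graph 1))))"
proof (cases "contains_chorded_cycle G (2 * k - 3) (2 * k + 1)")
  case True
  thus ?thesis ..
next
  case nc: False
  note G = assms(3)
  define r where "r = graph_spectral_radius G"
  define b where "b = 7 * (real k)\<^sup>2 + 6 * real k + 2"
  define q where "q = sqrt (4 * real m - (real k)\<^sup>2 + 1)"
  have k: "real k \<ge> 2" using assms(1) by simp
  have b0: "b \<ge> 0" by (simp add: b_def)
  have "4 * real m - (real k)\<^sup>2 + 1 \<ge> (b / 2)\<^sup>2"
    using assms(2) by (simp add: b_def power_divide field_simps)
  moreover from this have nn: "4 * real m - (real k)\<^sup>2 + 1 \<ge> 0" by (rule order.trans[OF zero_le_power2])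
  ultimately have q: "q \<ge> b / 2"
    unfolding q_def by (intro real_le_rsqrt)
  have q2: "q\<^sup>2 = 4 * real m - (real k)\<^sup>2 + 1" unfolding q_def by (rule real_sqrt_pow2[OF nn])
  have rq: "2 * r - (real k - 1) \<ge> q" using assms(6) by (simp add: r_def q_def)
  \<comment> \<open>This is how the bound on \<open>m\<close> enters: (k - 1 + b/2)/2 is exactly the
    right-hand side.\<close>
  have rge: "r \<ge> 7 / 4 * (real k)\<^sup>2 + 2 * real k"
    using rq q by (simp add: b_def)
  \<comment> \<open>The assumed bound on the spectral radius is the larger root of t^2 - (k - 1) t =
    m - k(k - 1)/2.\<close>
  have "q\<^sup>2 \<le> (2 * r - (real k - 1))\<^sup>2"
    using rq q b0 by (intro power_mono) auto
  hence size: "real m - real k * (real k - 1) / 2 \<le> r\<^sup>2 - (real k - 1) * r"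
    unfolding q2 by (simp add: power2_eq_square field_simps)
  have r0: "graph_spectral_radius G \<ge> 0"
    using rge k zero_le_power2[of "real k"] unfolding r_def by linarith
  have "b\<^sup>2 / 16 + ((real k)\<^sup>2 - 1) / 4 > 0"
    using k power_mono[of 2 "real k" 2] by (intro add_nonneg_pos) auto
  hence "m > 0" using assms(2) unfolding b_def by linarith
  hence "edges G \<noteq> {}" using assms(5) by auto
  hence ne: "verts G \<noteq> {}" using G by (fastforce simp: simple_graph_def)
  obtain x u where x: "\<forall>v\<in>verts G. 0 \<le> x v \<and> x v \<le> 1" "u \<in> verts G" "x u = (1::real)"
    "\<forall>v\<in>verts G. r * x v \<le> (\<Sum>w\<in>{w \<in> verts G. {v, w} \<in> edges G}. x w)"
    using spectral_radius_subharmonic[OF G ne r0] unfolding r_def by blast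
  interpret adjacency "\<lambda>v w. {v, w} \<in> edges G" by (rule adjacency_simple_graph[OF G])
  interpret extremal_setup "\<lambda>v w. {v, w} \<in> edges G" "verts G" x u r k
  proof
    fix c assume c: "is_cyc (verts G) c" "length c = 2 * k + 1" "u \<in> set c"
    show "card {w \<in> set c. {u, w} \<in> edges G} < 2 * k - 1"
    proof (rule ccontr)
      assume "\<not> ?thesis"
      hence "card {w \<in> set c. {u, w} \<in> edges G} \<ge> (2 * k - 3) + 2" using assms(1) by simp
      thus False using chorded_cycle_of_nbrs[OF G c(1,3)] nc c(2) by simp
    qed
  qed (use G x assms(1) rge size ecount_card_edges[OF G] assms(5) simple_graph_edgeD[OF G]
      in \<open>auto simp: simple_graph_def\<close>)
  obtain A where A: "A \<subseteq> verts G" "card A = k" "\<forall>a\<in>A. \<forall>b\<in>verts G - {a}. {a, b} \<in> edges G"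
    "\<forall>v\<in>verts G - A. \<forall>w\<in>verts G - A. {v, w} \<notin> edges G"
    using extremal_structure assms(4) unfolding isolate_free_def by blast
  have fA: "finite A" using A(1) fin finite_subset by blast
  have "\<forall>v\<in>verts G - A. {w \<in> verts G. {v, w} \<in> edges G} = A"
    using A E_sym by blast
  hence m: "real m = ecount A + real k * (real (card (verts G)) - real k)"
    using ecount_join_independent[OF fin A(1)] A(2) ecount_card_edges[OF G] assms(5) by simp
  have "deg A v = k - 1" if "v \<in> A" for v
    using deg_full_iff[OF fA that] A that by auto
  hence eA: "ecount A = real k * (real k - 1) / 2"
    using A(2) assms(1) by (simp add: ecount_def of_nat_diff)
  have cI: "real (card (verts G - A)) = real (card (verts G)) - real k"
    using A(1,2) fA card_mono[OF fin A(1)] by (simp add: card_Diff_subset of_nat_diff)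
  have "real m = real k * ((real k - 1) / 2 + real (card (verts G - A)))"
    unfolding m eA cI by (simp add: distrib_left)
  hence "real (card (verts G - A)) = real m / real k - (real k - 1) / 2"
    using k by simp
  thus ?thesis
    using graph_iso_complete_join_independent[OF G A] by blast
qed

end
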